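(* Let $0<d\le 1/2$ be fixed. (1) If $p=\omega(n^{-2/3})$, then for every sequence $(G_n)$ with $G_n\in\mathscr{G}_{d,n}$, asymptotically almost surely $G_n\cup\mathbb{G}(n,p)\xrightarrow{\mathrm{rbw}}K_6$. (2) For every fixed $\varepsilon>0$, if $p=n^{-(2/3+\varepsilon)}$, then there is a sequence $(G_n)$ with $G_n\in\mathscr{G}_{d,n}$ such that asymptotically almost surely $G_n\cup\mathbb{G}(n,p)$ does not satisfy $\xrightarrow{\mathrm{rbw}}K_6$.
   Context: For graphs $G,H$, write $G \xrightarrow{\mathrm{rbw}} H$ if every proper edge-colouring of $G$ contains a rainbow copy of $H$ (a subgraph all of whose edges receive distinct colours). $\mathbb{G}(n,p)$ is the binomial random graph. $\mathscr{G}_{d,n}$ denotes the family of $n$-vertex graphs with edge density at least $d$. $G\cup\mathbb{G}(n,p)$ denotes the union of a fixed $n$-vertex graph $G$ with an independent random graph $\mathbb{G}(n,p)$ on the same vertex set. "Asymptotically almost surely" means with probability tending to $1$ as $n\to\infty$. *)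

theory Defs
  imports Complex_Main
begin

text \<open>Graphs on vertex set {0..<n}, represented by their edge sets (sets of 2-element sets).\<close>

definition all_pairs :: "nat \<Rightarrow> nat set set" where
  "all_pairs n = {e. \<exists>u v. u < n \<and> v < n \<and> u \<noteq> v \<and> e = {u, v}}"

definition pairs_of :: "nat set \<Rightarrow> nat set set" where
  "pairs_of S = {e. \<exists>u v. u \<in> S \<and> v \<in> S \<and> u \<noteq> v \<and> e = {u, v}}"

definition edge_density :: "nat \<Rightarrow> nat set set \<Rightarrow> real" where
  "edge_density n E = real (card E) / real (n choose 2)"

definition dense_family :: "real \<Rightarrow> nat \<Rightarrow> nat set set set" where
  "dense_family d n = {E. E \<subseteq> all_pairs n \<and> edge_density n E \<ge> d}"

definition proper_colouring :: "nat set set \<Rightarrow> (nat set \<Rightarrow> nat) \<Rightarrow> bool" where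
  "proper_colouring E c \<longleftrightarrow>
     (\<forall>e\<in>E. \<forall>f\<in>E. e \<noteq> f \<and> e \<inter> f \<noteq> {} \<longrightarrow> c e \<noteq> c f)"

definition rbw_K6 :: "nat set set \<Rightarrow> bool" where
  "rbw_K6 E \<longleftrightarrow>
     (\<forall>c. proper_colouring E c \<longrightarrow>
        (\<exists>S. card S = 6 \<and> pairs_of S \<subseteq> E \<and> inj_on c (pairs_of S)))"

definition gnp_prob :: "nat \<Rightarrow> real \<Rightarrow> (nat set set \<Rightarrow> bool) \<Rightarrow> real" where
  "gnp_prob n p P =
     (\<Sum>R\<in>Pow (all_pairs n). if P R then
        p ^ card R * (1 - p) ^ (card (all_pairs n) - card R) else 0)"

end

theory Submission
  imports Defs "HOL-Library.Nat_Bijection" "HOL-Real_Asymp.Real_Asymp"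
begin

text \<open>
  Upper bound. Lowering \<open>p\<close> we may assume \<open>n p\<^sup>2 \<rightarrow> 0\<close>. Put \<open>q = n\<^sup>3 p\<^sup>3\<close>, so \<open>q\<close> is much larger than \<open>n\<close>. By second
  moments the random graph has of the order of \<open>q\<close> triangles, almost all of them edge-disjoint, and of the
  order of \<open>q\<^sup>2\<close> pairs \<open>(T, B)\<close> of triangles that are completely joined in \<open>G\<close>. In a proper colouring, a
  repeated colour on \<open>T \<union> B\<close> determines the pair from one of its triangles and one further vertex (up to a
  bounded choice), so only \<open>O(q n)\<close> of the pairs fail to be rainbow.

  Lower bound. Let \<open>G\<close> be balanced complete bipartite. Below \<open>n powr (- 2/3)\<close> every bounded set \<open>S\<close> of vertices
  spans fewer than \<open>3/2 |S|\<close> random edges and the classes of the equivalence relation on vertices generated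
  by lying in a common triangle are bounded. Then the vertices can be labelled injectively by numbers \<open>g\<close> such
  that each random triangle contains two vertices with consecutive labels. Colour a bipartite edge \<open>lr\<close> by
  \<open>g l - g r\<close> and all other edges by private colours. As the random graph has no \<open>K\<^sub>4\<close>, a \<open>K\<^sub>6\<close> consists of a
  triangle on each side, and joining the two consecutive pairs gives two edges of the same colour.
\<close>

section \<open>Expectations over a binomial random set\<close>

text \<open>Consecutive labels form paths, and a vertex has at most two neighbours on a path. The
  obstacle in the lower bound is therefore a vertex in the interior of its path that is needed for a
  further triangle. The integer 3|S| - 2e(S) keeps the account: it is 3 for a single vertex and
  never rises when a triangle meeting S is added, so as long as it stays positive at most two units
  can be lost, and each possibly interior vertex is paid for by one unit. The same integer stops the
  growth of a class: sets of a suitable bounded size have value at least 4, so no class can reach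
  that size. In the upper bound, p n^(2/3) tending to infinity is the same as q/n tending to
  infinity, and q/n is the ratio of the q^2 joined pairs to the qn failures. Lowering p is harmless
  because the property is increasing; it makes the order n^4 p^5 = q n p^2 of the number of pairs of
  triangles with a common edge small against q. Edge-disjointness matters because it lets two
  vertices determine a triangle when a failing pair is decoded.\<close>

definition gex :: "'a set \<Rightarrow> real \<Rightarrow> ('a set \<Rightarrow> real) \<Rightarrow> real" where
  "gex E p f = (\<Sum>R\<in>Pow E. p ^ card R * (1 - p) ^ (card E - card R) * f R)"

lemma gnp_prob_eq_gex: "gnp_prob n p P = gex (all_pairs n) p (\<lambda>R. of_bool (P R))"
  unfolding gnp_prob_def gex_def by (intro sum.cong) auto

lemma gex_empty [simp]: "gex {} p f = f {}"
  by (simp add: gex_def)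

text \<open>Conditioning on whether \<open>e\<close> is chosen. This recursion drives the inductions
  on the ground set.\<close>

lemma gex_insert:
  assumes "finite E" "e \<notin> E"
  shows "gex (insert e E) p f = p * gex E p (\<lambda>R. f (insert e R)) + (1 - p) * gex E p f"
proof -
  have inj: "inj_on (insert e) (Pow E)"
    using assms(2) by (auto simp: inj_on_def)
  have disj: "Pow E \<inter> insert e ` Pow E = {}"
    using assms(2) by auto
  have c1: "card (insert e R) = Suc (card R)" if "R \<in> Pow E" for R
    using that assms by (meson PowD card_insert_disjoint finite_subset in_mono)
  have c2: "card (insert e E) - card R = Suc (card E - card R)" if "R \<in> Pow E" for R
    using that assms card_mono[of E R] by (auto simp: Suc_diff_le)
  have "gex (insert e E) p f =
      (\<Sum>R\<in>Pow E. p ^ card R * (1 - p) ^ (card (insert e E) - card R) * f R) +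
      (\<Sum>R\<in>Pow E. p ^ card (insert e R) * (1 - p) ^ (card (insert e E) - card (insert e R)) * f (insert e R))"
    unfolding gex_def Pow_insert
    using assms disj by (subst sum.union_disjoint) (auto simp: sum.reindex[OF inj])
  also have "(\<Sum>R\<in>Pow E. p ^ card (insert e R) * (1 - p) ^ (card (insert e E) - card (insert e R)) * f (insert e R))
      = p * gex E p (\<lambda>R. f (insert e R))"
    unfolding gex_def sum_distrib_left using assms
    by (intro sum.cong) (auto simp: c1)
  also have "(\<Sum>R\<in>Pow E. p ^ card R * (1 - p) ^ (card (insert e E) - card R) * f R)
      = (1 - p) * gex E p f"
    unfolding gex_def sum_distrib_left by (intro sum.cong refl) (subst c2, auto)
  finally show ?thesis by simp
qed

lemma gex_const [simp]: "finite E \<Longrightarrow> gex E p (\<lambda>_. k) = k"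
  by (induction E rule: finite_induct) (auto simp: gex_insert algebra_simps)

lemma gex_add: "gex E p (\<lambda>R. f R + g R) = gex E p f + gex E p g"
  by (simp add: gex_def distrib_left sum.distrib)

lemma gex_diff: "gex E p (\<lambda>R. f R - g R) = gex E p f - gex E p g"
  by (simp add: gex_def right_diff_distrib sum_subtractf)

lemma gex_cmult: "gex E p (\<lambda>R. k * f R) = k * gex E p f"
  by (simp add: gex_def sum_distrib_left mult_ac)

lemma gex_sum: "gex E p (\<lambda>R. \<Sum>i\<in>I. f i R) = (\<Sum>i\<in>I. gex E p (f i))"
  unfolding gex_def sum_distrib_left by (rule sum.swap)

lemma gex_mono:
  assumes "0 \<le> p" "p \<le> 1" "\<And>R. R \<subseteq> E \<Longrightarrow> f R \<le> g R"
  shows "gex E p f \<le> gex E p g"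
  unfolding gex_def using assms by (intro sum_mono mult_left_mono) auto

lemma gex_cong:
  assumes "\<And>R. R \<subseteq> E \<Longrightarrow> f R = g R"
  shows "gex E p f = gex E p g"
  unfolding gex_def using assms by (intro sum.cong) auto

lemma gex_mem:
  assumes "finite E" "e \<in> E" and f: "\<And>R. f (insert e R) = f R"
  shows "gex E p (\<lambda>R. of_bool (e \<in> R) * f R) = p * gex E p f"
proof -
  define E' where "E' = E - {e}"
  have E: "E = insert e E'" "e \<notin> E'" "finite E'"
    using assms by (auto simp: E'_def)
  have z: "gex E' p (\<lambda>R. of_bool (e \<in> R) * f R) = 0"
    using E(2) gex_cong[of E' "\<lambda>R. of_bool (e \<in> R) * f R" "\<lambda>_. 0"] E(3) by auto
  show ?thesis
    unfolding E(1) gex_insert[OF E(3,2)] f by (simp add: z) (simp add: algebra_simps)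
qed

text \<open>Independence in elementary form: that \<open>f\<close> ignores the elements of
  \<open>S\<close> is expressed as invariance under inserting them, and these elements are split off
  one at a time.\<close>

lemma gex_subset_indep:
  assumes "finite E" "S \<subseteq> E" and f: "\<And>e R. e \<in> S \<Longrightarrow> f (insert e R) = f R"
  shows "gex E p (\<lambda>R. of_bool (S \<subseteq> R) * f R) = p ^ card S * gex E p f"
proof -
  have "finite S" using assms finite_subset by blast
  then show ?thesis using assms(2) f
  proof (induction S rule: finite_induct)
    case (insert e S)
    have "gex E p (\<lambda>R. of_bool (insert e S \<subseteq> R) * f R)
        = gex E p (\<lambda>R. of_bool (e \<in> R) * (of_bool (S \<subseteq> R) * f R))"
      by (intro gex_cong) auto
    also have "\<dots> = p * gex E p (\<lambda>R. of_bool (S \<subseteq> R) * f R)"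
    proof (rule gex_mem)
      show "of_bool (S \<subseteq> insert e R) * f (insert e R) = of_bool (S \<subseteq> R) * f R" for R
        using insert.hyps insert.prems by (auto simp: subset_insert)
    qed (use assms insert in auto)
    finally show ?case using insert by simp
  qed auto
qed

lemma gex_subset:
  assumes "finite E" "S \<subseteq> E"
  shows "gex E p (\<lambda>R. of_bool (S \<subseteq> R)) = p ^ card S"
  using gex_subset_indep[OF assms, of "\<lambda>_. 1"] assms by simp

lemma gex_markov:
  assumes "finite E" "0 \<le> p" "p \<le> 1" "a > 0" "\<And>R. R \<subseteq> E \<Longrightarrow> 0 \<le> f R"
  shows "gex E p (\<lambda>R. of_bool (f R \<ge> a)) \<le> gex E p f / a"
proof -
  have "gex E p (\<lambda>R. of_bool (f R \<ge> a)) \<le> gex E p (\<lambda>R. (1 / a) * f R)"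
    using assms by (intro gex_mono) (auto simp: of_bool_def)
  then show ?thesis by (simp only: gex_cmult) simp
qed

text \<open>Takes the place of a coupling of two random sets. The expectation is affine in the
  probability of the single element \<open>e\<close>, with a slope that is nonnegative for
  increasing \<open>f\<close>; the induction hypothesis treats the other elements.\<close>

lemma gex_mono_prob:
  assumes "finite E" "0 \<le> p" "p \<le> r" "r \<le> 1"
    and "\<And>R S. R \<subseteq> S \<Longrightarrow> f R \<le> f S"
  shows "gex E p f \<le> gex E r f"
  using assms(1,5)
proof (induction E arbitrary: f rule: finite_induct)
  case (insert e E)
  have 1: "gex E p (\<lambda>R. f (insert e R)) \<le> gex E r (\<lambda>R. f (insert e R))"
    by (rule insert.IH) (auto intro: insert.prems)
  have 2: "gex E p f \<le> gex E r f"
    by (rule insert.IH) (auto intro: insert.prems)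
  have 3: "gex E r f \<le> gex E r (\<lambda>R. f (insert e R))"
    using assms by (intro gex_mono insert.prems) auto
  have "p * gex E p (\<lambda>R. f (insert e R)) + (1 - p) * gex E p f
      \<le> p * gex E r (\<lambda>R. f (insert e R)) + (1 - p) * gex E r f"
    using 1 2 assms by (intro add_mono mult_left_mono) auto
  also have "\<dots> = gex E r f + p * (gex E r (\<lambda>R. f (insert e R)) - gex E r f)"
    by (simp add: algebra_simps)
  also have "\<dots> \<le> gex E r f + r * (gex E r (\<lambda>R. f (insert e R)) - gex E r f)"
    using 3 assms by (intro add_left_mono mult_right_mono) auto
  also have "\<dots> = r * gex E r (\<lambda>R. f (insert e R)) + (1 - r) * gex E r f"
    by (simp add: algebra_simps)
  finally show ?case using insert.hyps by (simp add: gex_insert)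
qed auto

section \<open>Pairs of vertices and elementary probabilities in the binomial random graph\<close>

lemma finite_all_pairs [simp]: "finite (all_pairs n)"
proof (rule finite_subset)
  show "all_pairs n \<subseteq> Pow {..<n}" by (auto simp: all_pairs_def)
qed simp

lemma pairs_of_eq: "pairs_of S = {e. e \<subseteq> S \<and> card e = 2}"
  by (auto simp: pairs_of_def card_2_iff)

lemma all_pairs_eq: "all_pairs n = pairs_of {..<n}"
  by (auto simp: pairs_of_def all_pairs_def)

lemma pairs_of_mono: "S \<subseteq> T \<Longrightarrow> pairs_of S \<subseteq> pairs_of T"
  by (auto simp: pairs_of_eq)

lemma pairs_of_Int: "pairs_of (S \<inter> T) = pairs_of S \<inter> pairs_of T"
  by (auto simp: pairs_of_eq)

lemma finite_pairs_of [simp]: "finite S \<Longrightarrow> finite (pairs_of S)"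
  by (auto simp: pairs_of_eq)

lemma card_pairs_of: "finite S \<Longrightarrow> card (pairs_of S) = card S choose 2"
  by (simp add: pairs_of_eq n_subsets)

lemma doubleton_in_pairs_of [simp]: "{x, y} \<in> pairs_of S \<longleftrightarrow> x \<in> S \<and> y \<in> S \<and> x \<noteq> y"
  by (auto simp: pairs_of_eq card_2_iff doubleton_eq_iff)

lemma gnp_prob_compl: "gnp_prob n p (\<lambda>R. \<not> P R) = 1 - gnp_prob n p P"
proof -
  have "gnp_prob n p (\<lambda>R. \<not> P R) = gex (all_pairs n) p (\<lambda>R. 1 - of_bool (P R))"
    unfolding gnp_prob_eq_gex by (intro gex_cong) auto
  then show ?thesis by (simp add: gex_diff gnp_prob_eq_gex)
qed

lemma gnp_prob_mono:
  assumes "0 \<le> p" "p \<le> 1" "\<And>R. R \<subseteq> all_pairs n \<Longrightarrow> P R \<Longrightarrow> Q R"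
  shows "gnp_prob n p P \<le> gnp_prob n p Q"
  unfolding gnp_prob_eq_gex using assms by (intro gex_mono) auto

lemma gnp_prob_disj:
  assumes "0 \<le> p" "p \<le> 1"
  shows "gnp_prob n p (\<lambda>R. P R \<or> Q R) \<le> gnp_prob n p P + gnp_prob n p Q"
  unfolding gnp_prob_eq_gex gex_add[symmetric] using assms by (intro gex_mono) auto

lemma gnp_prob_UN:
  assumes "0 \<le> p" "p \<le> 1" "finite I"
  shows "gnp_prob n p (\<lambda>R. \<exists>i\<in>I. P i R) \<le> (\<Sum>i\<in>I. gnp_prob n p (P i))"
proof -
  have "of_bool (\<exists>i\<in>I. P i R) \<le> (\<Sum>i\<in>I. of_bool (P i R) :: real)" for R
  proof (cases "\<exists>i\<in>I. P i R")
    case True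
    then obtain i where i: "i \<in> I" "P i R" by auto
    have "of_bool (P i R) \<le> (\<Sum>i\<in>I. of_bool (P i R) :: real)"
      using assms(3) i by (intro member_le_sum) auto
    then show ?thesis using i by auto
  qed (simp add: sum_nonneg)
  then show ?thesis
    unfolding gnp_prob_eq_gex gex_sum[symmetric] using assms by (intro gex_mono) auto
qed

lemma gnp_prob_nonneg:
  assumes "0 \<le> p" "p \<le> 1"
  shows "0 \<le> gnp_prob n p P"
  unfolding gnp_prob_eq_gex gex_def using assms by (intro sum_nonneg) auto

lemma gnp_prob_subset:
  assumes "F \<subseteq> all_pairs n"
  shows "gnp_prob n p (\<lambda>R. F \<subseteq> R) = p ^ card F"
  unfolding gnp_prob_eq_gex using assms by (simp add: gex_subset)

section \<open>Ordering the vertices of a sparse graph along its triangles\<close>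

definition triangle :: "nat set set \<Rightarrow> nat set \<Rightarrow> bool" where
  "triangle E T \<longleftrightarrow> card T = 3 \<and> pairs_of T \<subseteq> E"

definition nbrs :: "nat set set \<Rightarrow> nat set \<Rightarrow> nat \<Rightarrow> nat set" where
  "nbrs E S u = {v \<in> S. {u, v} \<in> E}"

definition edges_in :: "nat set set \<Rightarrow> nat set \<Rightarrow> nat set set" where
  "edges_in E S = E \<inter> pairs_of S"

text \<open>Positive exactly when \<open>S\<close> spans fewer than 3/2 |S| edges. A vertex and a
  triangle both have potential 3, hanging a triangle on one vertex leaves it unchanged, and each
  vertex added with two edges costs one unit.\<close>

definition potential :: "nat set set \<Rightarrow> nat set \<Rightarrow> int" where
  "potential E S = 3 * int (card S) - 2 * int (card (edges_in E S))"

lemma potential_insert: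
  assumes "finite S" "u \<notin> S"
  shows "potential E (insert u S) = potential E S + 3 - 2 * int (card (nbrs E S u))"
proof -
  have "edges_in E (insert u S) = edges_in E S \<union> (\<lambda>v. {u, v}) ` nbrs E S u"
    using assms(2) by (auto simp: edges_in_def nbrs_def pairs_of_def insert_commute)
  moreover have "edges_in E S \<inter> (\<lambda>v. {u, v}) ` nbrs E S u = {}"
    using assms(2) by (auto simp: edges_in_def pairs_of_eq)
  moreover have "card ((\<lambda>v. {u, v}) ` nbrs E S u) = card (nbrs E S u)"
    by (intro card_image) (auto simp: inj_on_def doubleton_eq_iff)
  ultimately have "card (edges_in E (insert u S)) = card (edges_in E S) + card (nbrs E S u)"
    using assms(1) by (simp add: card_Un_disjoint edges_in_def nbrs_def)
  then show ?thesis using assms by (simp add: potential_def)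
qed

lemma triangle_nbrs:
  assumes "triangle E T" "u \<in> T" "T \<subseteq> insert u S" "u \<notin> S"
  obtains v w where "T = {u, v, w}" "v \<noteq> w" "v \<in> nbrs E S u" "w \<in> nbrs E S u"
proof -
  have "card (T - {u}) = 2" using assms by (simp add: triangle_def)
  then obtain v w where vw: "T - {u} = {v, w}" "v \<noteq> w" by (auto simp: card_2_iff)
  then have T: "T = {u, v, w}" using assms(2) by blast
  have "{u, v} \<in> pairs_of T" "{u, w} \<in> pairs_of T" using vw T by auto
  then have "{u, v} \<in> E" "{u, w} \<in> E" using assms(1) by (auto simp: triangle_def)
  moreover have "v \<in> S" "w \<in> S" using vw assms by auto
  ultimately show ?thesis using that[OF T] vw by (auto simp: nbrs_def)
qed

lemma triangle_inside_nbrs: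
  assumes "triangle E T" "u \<in> T" "T \<subseteq> insert u S" "u \<notin> S" "nbrs E S u = {v, w}"
  shows "T = {u, v, w}"
proof -
  obtain v' w' where "T = {u, v', w'}" "v' \<noteq> w'" "v' \<in> nbrs E S u" "w' \<in> nbrs E S u"
    using triangle_nbrs[OF assms(1-4)] .
  then show ?thesis using assms(5) by auto
qed

lemma triangle_nbrs_singleton:
  assumes "triangle E T" "u \<in> T" "T \<subseteq> insert u S" "u \<notin> S" "nbrs E S u = {v}"
  shows False
proof -
  obtain v' w' where "T = {u, v', w'}" "v' \<noteq> w'" "v' \<in> nbrs E S u" "w' \<in> nbrs E S u"
    using triangle_nbrs[OF assms(1-4)] .
  then show ?thesis using assms(5) by auto
qed

section \<open>Families of paths that meet every triangle, extended triangle by triangle\<close>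

definition hits :: "'a list \<Rightarrow> 'a set \<Rightarrow> bool" where
  "hits p T \<longleftrightarrow> (\<exists>xs ys. \<exists>x\<in>T. \<exists>y\<in>T. p = xs @ x # y # ys)"

lemma hitsI: "x \<in> T \<Longrightarrow> y \<in> T \<Longrightarrow> p = xs @ x # y # ys \<Longrightarrow> hits p T"
  unfolding hits_def by blast

lemma hits_rev:
  assumes "hits p T"
  shows "hits (rev p) T"
proof -
  obtain xs ys x y where "x \<in> T" "y \<in> T" "p = xs @ x # y # ys"
    using assms unfolding hits_def by blast
  then show ?thesis by (intro hitsI[of y T x _ "rev ys" "rev xs"]) auto
qed

lemma hits_append:
  assumes "hits p T"
  shows "hits (us @ p @ vs) T"
proof -
  obtain xs ys x y where "x \<in> T" "y \<in> T" "p = xs @ x # y # ys"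
    using assms unfolding hits_def by blast
  then show ?thesis by (intro hitsI[of x T y _ "us @ xs" "ys @ vs"]) auto
qed

lemma hits_Cons_Cons: "x \<in> T \<Longrightarrow> y \<in> T \<Longrightarrow> hits (x # y # ys) T"
  by (rule hitsI[where xs = "[]"]) auto

lemma hits_Cons: "hits p T \<Longrightarrow> hits (x # p) T"
  using hits_append[of p T "[x]" "[]"] by simp

definition is_end :: "'a list list \<Rightarrow> 'a \<Rightarrow> bool" where
  "is_end ps v \<longleftrightarrow> (\<exists>p\<in>set ps. p \<noteq> [] \<and> (hd p = v \<or> last p = v))"

text \<open>The path ending in \<open>a\<close> is reversed if necessary so that \<open>a\<close>
  comes first, and \<open>u\<close> is put in front. Reversal keeps consecutive pairs consecutive.
  Only \<open>a\<close> may cease to be an end and \<open>u\<close> becomes one, which is what the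
  account of interior vertices needs.\<close>

lemma attach_path:
  assumes "distinct (concat ps)" "u \<notin> set (concat ps)" "is_end ps a"
  shows "\<exists>ps'. distinct (concat ps') \<and> set (concat ps') = insert u (set (concat ps)) \<and>
    (\<forall>T. (\<exists>p\<in>set ps. hits p T) \<longrightarrow> (\<exists>p\<in>set ps'. hits p T)) \<and>
    (\<forall>T. u \<in> T \<longrightarrow> a \<in> T \<longrightarrow> (\<exists>p\<in>set ps'. hits p T)) \<and>
    is_end ps' u \<and> (\<forall>v. v \<noteq> a \<longrightarrow> is_end ps v \<longrightarrow> is_end ps' v)"
proof -
  obtain p where p: "p \<in> set ps" "p \<noteq> []" "hd p = a \<or> last p = a"
    using assms(3) by (auto simp: is_end_def)
  obtain q where q: "q = p \<or> q = rev p" "hd q = a"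
    using p by (metis hd_rev)
  have qset: "set q = set p" "distinct q = distinct p" "q \<noteq> []" using q p by auto
  obtain ps1 ps2 where ps: "ps = ps1 @ p # ps2" using p by (meson split_list)
  define ps' where "ps' = ps1 @ (u # q) # ps2"
  obtain q' where q': "q = a # q'" using qset q by (cases q) auto
  have hq: "hits (u # q) T" if "hits p T" for T
    using that q(1) hits_rev[of p T] hits_Cons[of _ T u] by auto
  show ?thesis
  proof (intro exI[of _ ps'] conjI allI impI)
    show "distinct (concat ps')" "set (concat ps') = insert u (set (concat ps))"
      using assms qset by (auto simp: ps ps'_def)
    show "\<exists>p\<in>set ps'. hits p T" if "\<exists>p\<in>set ps. hits p T" for T
      using that hq by (auto simp: ps ps'_def)
    show "\<exists>p\<in>set ps'. hits p T" if "u \<in> T" "a \<in> T" for T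
      using that q' by (auto simp: ps'_def intro: hits_Cons_Cons)
    show "is_end ps' u" by (auto simp: is_end_def ps'_def)
    show "is_end ps' v" if v: "v \<noteq> a" "is_end ps v" for v
    proof -
      obtain r where r: "r \<in> set ps" "r \<noteq> []" "hd r = v \<or> last r = v"
        using v by (auto simp: is_end_def)
      show ?thesis
      proof (cases "r = p")
        case True
        then have "hd q = v \<or> last q = v" using r q by (auto simp: hd_rev last_rev)
        then have "last (u # q) = v" using q v qset by auto
        then show ?thesis unfolding is_end_def ps'_def by (intro bexI[of _ "u # q"]) auto
      next
        case False
        then show ?thesis using r by (auto simp: is_end_def ps'_def ps)
      qed
    qed
  qed
qed

text \<open>The set \<open>I\<close> collects the vertices that may be interior to their path; each loss of potential below
  the initial value 3 pays for one such vertex.\<close>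

definition path_cover :: "nat set set \<Rightarrow> nat set \<Rightarrow> nat set \<Rightarrow> nat list list \<Rightarrow> bool" where
  "path_cover E S I ps \<longleftrightarrow> distinct (concat ps) \<and> set (concat ps) = S \<and> finite I \<and>
     int (card I) + potential E S \<le> 3 \<and> (\<forall>v\<in>S - I. is_end ps v) \<and>
     (\<forall>T. triangle E T \<and> T \<subseteq> S \<longrightarrow> (\<exists>p\<in>set ps. hits p T))"

text \<open>One new vertex. Being in a triangle it has at least two neighbours in \<open>S\<close>,
  and a third would push the potential below 1. So there are exactly two,
  \<open>potential E S\<close> was at least 2, and \<open>I\<close> has at most one element: one of
  the two neighbours is still an end, and \<open>u\<close> is attached there. The only new triangle
  is then met, and the lost unit pays for that neighbour.\<close>

lemma path_cover_attach:
  assumes pc: "path_cover E S I ps" and u: "u \<notin> S"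
    and T: "triangle E T" "u \<in> T" "T \<subseteq> insert u S" and pos: "potential E (insert u S) \<ge> 1"
  shows "\<exists>I' ps'. path_cover E (insert u S) I' ps'"
proof -
  have finS: "finite S" using pc by (auto simp: path_cover_def)
  obtain v w where vw: "T = {u, v, w}" "v \<noteq> w" "v \<in> nbrs E S u" "w \<in> nbrs E S u"
    using triangle_nbrs[OF T u] .
  have fin: "finite (nbrs E S u)" using finS by (simp add: nbrs_def)
  have ge2: "card (nbrs E S u) \<ge> 2"
    using vw card_mono[OF fin, of "{v, w}"] by auto
  have pot: "potential E (insert u S) = potential E S + 3 - 2 * int (card (nbrs E S u))"
    using potential_insert[OF finS u] .
  have le: "int (card I) + potential E S \<le> 3" using pc by (auto simp: path_cover_def)
  have c2: "card (nbrs E S u) = 2" using ge2 pot pos le by linarith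
  have nb: "nbrs E S u = {v, w}"
    using card_subset_eq[OF fin, of "{v, w}"] vw c2 by auto
  have "card I \<le> 1" using pot pos le c2 by linarith
  then have "\<not> {v, w} \<subseteq> I"
    using vw pc card_mono[of I "{v, w}"] by (auto simp: path_cover_def)
  then obtain a where a: "a \<in> {v, w}" "a \<notin> I" by auto
  have aS: "a \<in> S" using a vw by (auto simp: nbrs_def)
  have "is_end ps a" "distinct (concat ps)" "u \<notin> set (concat ps)"
    using a aS pc u by (auto simp: path_cover_def)
  note end_ps = this
  obtain ps' where ps': "distinct (concat ps')" "set (concat ps') = insert u (set (concat ps))"
    "\<forall>T. (\<exists>p\<in>set ps. hits p T) \<longrightarrow> (\<exists>p\<in>set ps'. hits p T)"
    "\<forall>T. u \<in> T \<longrightarrow> a \<in> T \<longrightarrow> (\<exists>p\<in>set ps'. hits p T)"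
    "is_end ps' u" "\<forall>v. v \<noteq> a \<longrightarrow> is_end ps v \<longrightarrow> is_end ps' v"
    using attach_path[OF end_ps(2,3,1)] by (elim exE conjE)
  have "path_cover E (insert u S) (insert a I) ps'"
    unfolding path_cover_def
  proof (intro conjI allI impI)
    have "card (insert a I) \<le> Suc (card I)" by (simp add: card_insert_le_m1 card_insert_if pc)
    then show "int (card (insert a I)) + potential E (insert u S) \<le> 3"
      using pot c2 le by linarith
    show "set (concat ps') = insert u S" using ps' pc by (auto simp: path_cover_def)
    show "\<forall>v\<in>insert u S - insert a I. is_end ps' v"
      using ps'(5) ps'(6)[rule_format] pc by (auto simp: path_cover_def)
    show "\<exists>p\<in>set ps'. hits p T'" if T': "triangle E T' \<and> T' \<subseteq> insert u S" for T'
    proof (cases "u \<in> T'")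
      case True
      then have "T' = {u, v, w}" using triangle_inside_nbrs[of E T' u S v w] T' nb u by auto
      then show ?thesis using ps'(4)[rule_format, of T'] a by auto
    next
      case False
      then have "T' \<subseteq> S" using T' by auto
      then have "\<exists>p\<in>set ps. hits p T'" using T' pc unfolding path_cover_def by blast
      then show ?thesis using ps'(3) by blast
    qed
  qed (use ps' pc in \<open>auto simp: path_cover_def\<close>)
  then show ?thesis by blast
qed

text \<open>Two new vertices, one with an extra neighbour \<open>w\<close> in \<open>S\<close>. The
  potential drops by 2, hence it was 3 and \<open>I\<close> was empty. The new triangles can only be
  {x, y, z} and {x, y, w}; both contain \<open>x\<close> and \<open>y\<close>, so attaching
  \<open>y\<close> to \<open>x\<close> serves both, and \<open>z\<close> forms a path of its
  own.\<close>

lemma path_cover_attach2: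
  assumes pc: "path_cover E S I ps" and yz: "y \<notin> S" "z \<notin> S" "y \<noteq> z"
    and x: "x \<in> S" "{x, y} \<in> E" "{x, z} \<in> E" "{y, z} \<in> E"
    and ny: "nbrs E S y = {x, w}" and nz: "nbrs E S z = {x}" and wx: "w \<noteq> x"
    and pos: "potential E (insert z (insert y S)) \<ge> 1"
  shows "\<exists>I' ps'. path_cover E (insert z (insert y S)) I' ps'"
proof -
  have finS: "finite S" using pc by (auto simp: path_cover_def)
  have nz': "nbrs E (insert y S) z = {y, x}" 
    using nz x by (auto simp: nbrs_def insert_commute)
  have pot: "potential E (insert z (insert y S)) = potential E S - 2"
    using potential_insert[OF finS yz(1), of E] potential_insert[of "insert y S" z E] finS yz wx x
    by (auto simp: ny nz' card_insert_if)
  have le: "int (card I) + potential E S \<le> 3" using pc by (auto simp: path_cover_def)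
  then have cI: "card I = 0" "potential E S = 3" using pot pos by linarith+
  then have I: "I = {}" using pc by (auto simp: path_cover_def)
  have "is_end ps x" "distinct (concat ps)" "y \<notin> set (concat ps)"
    using x pc I yz by (auto simp: path_cover_def)
  note end_ps = this
  obtain ps' where ps': "distinct (concat ps')" "set (concat ps') = insert y (set (concat ps))"
    "\<forall>T. (\<exists>p\<in>set ps. hits p T) \<longrightarrow> (\<exists>p\<in>set ps'. hits p T)"
    "\<forall>T. y \<in> T \<longrightarrow> x \<in> T \<longrightarrow> (\<exists>p\<in>set ps'. hits p T)"
    "is_end ps' y" "\<forall>v. v \<noteq> x \<longrightarrow> is_end ps v \<longrightarrow> is_end ps' v"
    using attach_path[OF end_ps(2,3,1)] by (elim exE conjE)
  have "path_cover E (insert z (insert y S)) {x} ([z] # ps')"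
    unfolding path_cover_def
  proof (intro conjI allI impI)
    show "\<forall>v\<in>insert z (insert y S) - {x}. is_end ([z] # ps') v"
      using ps'(5) ps'(6)[rule_format] pc I by (auto simp: path_cover_def is_end_def)
    show "\<exists>p\<in>set ([z] # ps'). hits p T'" if T': "triangle E T' \<and> T' \<subseteq> insert z (insert y S)" for T'
    proof (cases "z \<in> T'")
      case True
      then have "T' = {z, y, x}"
        using triangle_inside_nbrs[of E T' z "insert y S" y x] T' nz' yz by auto
      then show ?thesis using ps'(4)[rule_format, of T'] by auto
    next
      case z: False
      show ?thesis
      proof (cases "y \<in> T'")
        case True
        then have "T' = {y, x, w}"
          using triangle_inside_nbrs[of E T' y S x w] T' z yz ny by auto
        then show ?thesis using ps'(4)[rule_format, of T'] by auto
      next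
        case False
        then have "T' \<subseteq> S" using T' z by auto
        then have "\<exists>p\<in>set ps. hits p T'" using T' pc unfolding path_cover_def by blast
        then show ?thesis using ps'(3) by auto
      qed
    qed
  qed (use ps' pc yz pot cI in \<open>auto simp: path_cover_def\<close>)
  then show ?thesis by blast
qed

text \<open>The triangle hangs on \<open>x\<close> alone and costs no potential. The separate path
  \<open>[y, z]\<close> meets it, so \<open>x\<close> stays as it was and both new vertices are
  ends.\<close>

lemma path_cover_new_pair:
  assumes pc: "path_cover E S I ps" and yz: "y \<notin> S" "z \<notin> S" "y \<noteq> z"
    and x: "x \<in> S" "{x, y} \<in> E" "{x, z} \<in> E" "{y, z} \<in> E"
    and ny: "nbrs E S y = {x}" and nz: "nbrs E S z = {x}"
  shows "\<exists>I' ps'. path_cover E (insert z (insert y S)) I' ps'"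
proof -
  have finS: "finite S" using pc by (auto simp: path_cover_def)
  have nz': "nbrs E (insert y S) z = {y, x}" 
    using nz x by (auto simp: nbrs_def insert_commute)
  have pot: "potential E (insert z (insert y S)) = potential E S"
    using potential_insert[OF finS yz(1), of E] potential_insert[of "insert y S" z E] finS yz x
    by (auto simp: ny nz' card_insert_if)
  have "path_cover E (insert z (insert y S)) I ([y, z] # ps)"
    unfolding path_cover_def
  proof (intro conjI allI impI)
    show "\<exists>p\<in>set ([y, z] # ps). hits p T'" if T': "triangle E T' \<and> T' \<subseteq> insert z (insert y S)" for T'
    proof (cases "z \<in> T'")
      case True
      then have "T' = {z, y, x}"
        using triangle_inside_nbrs[of E T' z "insert y S" y x] T' nz' yz by auto
      then have "hits [y, z] T'" by (intro hits_Cons_Cons) auto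
      then show ?thesis by auto
    next
      case z: False
      then have "y \<notin> T'"
        using triangle_nbrs_singleton[of E T' y S x] T' ny yz by auto
      then have "T' \<subseteq> S" using T' z by auto
      then have "\<exists>p\<in>set ps. hits p T'" using T' pc unfolding path_cover_def by blast
      then show ?thesis by auto
    qed
  qed (use pc yz pot in \<open>auto simp: path_cover_def is_end_def\<close>)
  then show ?thesis by blast
qed

text \<open>With two new vertices the potential changes by 4 minus twice the number of edges from
  them to \<open>S\<close>. As it goes from at most 3 to at least 1, there are at most three such
  edges; each new vertex has one to \<open>x\<close>, so only the degrees (1,1), (2,1) and (1,2)
  remain.\<close>

lemma path_cover_step:
  assumes pc: "path_cover E S I ps"
    and T: "triangle E T" "T \<inter> S \<noteq> {}" "\<not> T \<subseteq> S" and pos: "potential E (S \<union> T) \<ge> 1"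
  shows "\<exists>I' ps'. path_cover E (S \<union> T) I' ps'"
proof -
  have finS: "finite S" using pc by (auto simp: path_cover_def)
  have cT: "card T = 3" "finite T" using T by (auto simp: triangle_def intro: card_ge_0_finite)
  obtain x where x: "x \<in> T" "x \<in> S" using T by blast
  obtain y where y: "y \<in> T" "y \<notin> S" using T by blast
  have xy: "x \<noteq> y" using x y by auto
  have "card (T - {x, y}) = 1" using cT x y xy by (subst card_Diff_subset) auto
  then obtain z where "T - {x, y} = {z}" by (auto simp: card_1_singleton_iff)
  then have T3: "T = {x, y, z}" and zxy: "z \<noteq> x" "z \<noteq> y" using x y by auto
  have "{x, y} \<in> pairs_of T" "{x, z} \<in> pairs_of T" "{y, z} \<in> pairs_of T" using T3 zxy xy by auto
  then have E: "{x, y} \<in> E" "{x, z} \<in> E" "{y, z} \<in> E" using T unfolding triangle_def by blast+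
  show ?thesis
  proof (cases "z \<in> S")
    case True
    then have "S \<union> T = insert y S" using T3 x by auto
    then show ?thesis using path_cover_attach[OF pc y(2) T(1) y(1)] pos by auto
  next
    case z: False
    have ST: "S \<union> T = insert z (insert y S)" using T3 x by auto
    have fn: "finite (nbrs E S v)" for v using finS by (simp add: nbrs_def)
    have xn: "x \<in> nbrs E S y" "x \<in> nbrs E S z" using E x by (auto simp: nbrs_def insert_commute)
    have nz': "nbrs E (insert y S) z = insert y (nbrs E S z)"
      using E by (auto simp: nbrs_def insert_commute)
    have ynz: "y \<notin> nbrs E S z" using y by (simp add: nbrs_def)
    have "potential E (S \<union> T) = potential E S + 4 - 2 * int (card (nbrs E S y)) - 2 * int (card (nbrs E S z))"
      unfolding ST using potential_insert[OF finS y(2), of E] potential_insert[of "insert y S" z E] finS z zxy ynz fn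
      by (simp add: nz')
    moreover have "potential E S \<le> 3" using pc by (auto simp: path_cover_def)
    ultimately have sum: "card (nbrs E S y) + card (nbrs E S z) \<le> 3" using pos by linarith
    have c0: "card (nbrs E S y) \<noteq> 0" "card (nbrs E S z) \<noteq> 0" using xn fn by auto
    have one: "nbrs E S v = {x}" if "card (nbrs E S v) = 1" "x \<in> nbrs E S v" for v
      using that by (auto simp: card_1_singleton_iff)
    have two: "\<exists>w. nbrs E S v = {x, w} \<and> w \<noteq> x" if "card (nbrs E S v) = 2" "x \<in> nbrs E S v" for v
      using that by (auto simp: card_2_iff)
    consider "card (nbrs E S y) = 1" "card (nbrs E S z) = 1"
      | "card (nbrs E S y) = 2" "card (nbrs E S z) = 1"
      | "card (nbrs E S y) = 1" "card (nbrs E S z) = 2"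
      using sum c0 by linarith
    then show ?thesis
    proof cases
      case 1
      show ?thesis unfolding ST
        by (rule path_cover_new_pair[OF pc y(2) z _ x(2) E one one]) (use 1 zxy xn in auto)
    next
      case 2
      obtain w where "nbrs E S y = {x, w}" "w \<noteq> x" using two[OF 2(1) xn(1)] by auto
      then show ?thesis unfolding ST
        by (intro path_cover_attach2[OF pc y(2) z _ x(2) E _ one]) (use 2 zxy xn pos ST in auto)
    next
      case 3
      obtain w where "nbrs E S z = {x, w}" "w \<noteq> x" using two[OF 3(2) xn(2)] by auto
      moreover have "S \<union> T = insert y (insert z S)" using ST by auto
      ultimately show ?thesis
        using path_cover_attach2[OF pc z y(2) _ x(2) E(2,1) _ _ one, of w] 3 zxy xn pos E
        by (auto simp: insert_commute)
    qed
  qed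
qed


section \<open>Bounded classes and the concatenation of their paths\<close>

lemma subset_if_pairs_of_subset:
  assumes "pairs_of S \<subseteq> pairs_of V" "card S \<ge> 2"
  shows "S \<subseteq> V"
proof
  fix x assume x: "x \<in> S"
  have "S \<noteq> {x}" using assms by auto
  then obtain y where "y \<in> S" "y \<noteq> x" using x by blast
  then have "{x, y} \<in> pairs_of V" using assms(1) x by (metis doubleton_in_pairs_of subsetD)
  then show "x \<in> V" by simp
qed

lemma triangle_subset:
  assumes "triangle E T" "E \<subseteq> pairs_of V"
  shows "T \<subseteq> V"
  using assms by (intro subset_if_pairs_of_subset) (auto simp: triangle_def)

text \<open>The closed sets are the unions of classes of the equivalence relation generated by
  common triangles.\<close>

definition triangle_closed :: "nat set set \<Rightarrow> nat set \<Rightarrow> bool" where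
  "triangle_closed E S \<longleftrightarrow> (\<forall>T. triangle E T \<and> T \<inter> S \<noteq> {} \<longrightarrow> T \<subseteq> S)"

text \<open>A step adds one or two vertices, so a set of size below \<open>D\<close> cannot outgrow
  \<open>D\<close> without having size \<open>D\<close> or \<open>Suc D\<close>. There the potential
  would be at least 4, while a path cover forces it to be at most 3. Growth thus ends in a closed
  set below size \<open>D\<close>. The vertices \<open>W\<close> ordered earlier form a closed set,
  so they are never touched.\<close>

lemma path_cover_grow:
  assumes fin: "finite V" and EV: "E \<subseteq> pairs_of V"
    and pos: "\<And>S. S \<subseteq> V \<Longrightarrow> S \<noteq> {} \<Longrightarrow> card S \<le> Suc D \<Longrightarrow> potential E S \<ge> 1"
    and big: "\<And>S. S \<subseteq> V \<Longrightarrow> card S = D \<or> card S = Suc D \<Longrightarrow> potential E S \<ge> 4"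
    and W: "triangle_closed E W"
    and S: "path_cover E S I ps" "S \<subseteq> V" "S \<inter> W = {}" "v \<in> S" "card S < D"
  shows "\<exists>S I ps. path_cover E S I ps \<and> S \<subseteq> V \<and> S \<inter> W = {} \<and> v \<in> S \<and> triangle_closed E S"
  using S
proof (induction "D - card S" arbitrary: S I ps rule: less_induct)
  case less
  show ?case
  proof (cases "triangle_closed E S")
    case True
    then show ?thesis using less.prems by blast
  next
    case False
    then obtain T where T: "triangle E T" "T \<inter> S \<noteq> {}" "\<not> T \<subseteq> S" by (auto simp: triangle_closed_def)
    have TV: "T \<subseteq> V" using triangle_subset[OF T(1) EV] .
    have finS: "finite S" "finite T" using less.prems(2) TV fin finite_subset by auto
    have TW: "T \<inter> W = {}" using W T less.prems(3) by (auto simp: triangle_closed_def)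
    have "card (T \<inter> S) > 0" using T finS by (simp add: card_gt_0_iff)
    then have "card (S \<union> T) + 1 \<le> card S + card T"
      using card_Un_Int[OF finS] by (simp add: Int_commute)
    then have le: "card (S \<union> T) \<le> card S + 2" using T by (simp add: triangle_def)
    have gt: "card S < card (S \<union> T)"
      using T finS by (intro psubset_card_mono) auto
    have "potential E (S \<union> T) \<ge> 1"
      using le less.prems TV by (intro pos) auto
    then obtain I' ps' where pc: "path_cover E (S \<union> T) I' ps'"
      using path_cover_step[OF less.prems(1) T] by blast
    then have "potential E (S \<union> T) \<le> 3" by (auto simp: path_cover_def)
    then have "\<not> (card (S \<union> T) = D \<or> card (S \<union> T) = Suc D)"
      using big[of "S \<union> T"] less.prems(2) TV by auto
    then have lt: "card (S \<union> T) < D" using le less.prems(5) by auto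
    show ?thesis
    proof (rule less.hyps[OF _ pc])
      show "(S \<union> T) \<inter> W = {}" using less.prems(3) TW by blast
    qed (use gt lt less.prems TV in auto)
  qed
qed

lemma triangle_ordering:
  assumes fin: "finite V" and EV: "E \<subseteq> pairs_of V" and D: "D \<ge> 2"
    and pos: "\<And>S. S \<subseteq> V \<Longrightarrow> S \<noteq> {} \<Longrightarrow> card S \<le> Suc D \<Longrightarrow> potential E S \<ge> 1"
    and big: "\<And>S. S \<subseteq> V \<Longrightarrow> card S = D \<or> card S = Suc D \<Longrightarrow> potential E S \<ge> 4"
  shows "\<exists>xs. distinct xs \<and> set xs = V \<and> (\<forall>T. triangle E T \<longrightarrow> hits xs T)"
proof -
  have "\<exists>xs. distinct xs \<and> set xs = V \<and> (\<forall>T. triangle E T \<longrightarrow> hits xs T)"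
    if "distinct xs" "set xs \<subseteq> V" "triangle_closed E (set xs)"
      "\<And>T. triangle E T \<Longrightarrow> T \<subseteq> set xs \<Longrightarrow> hits xs T" for xs
    using that
  proof (induction "card V - card (set xs)" arbitrary: xs rule: less_induct)
    case less
    show ?case
    proof (cases "set xs = V")
      case True
      then show ?thesis using less.prems triangle_subset[OF _ EV] by blast
    next
      case False
      then obtain v where v: "v \<in> V" "v \<notin> set xs" using less.prems by blast
      have "edges_in E {v} = {}" by (auto simp: edges_in_def pairs_of_def)
      moreover have "\<not> (triangle E T \<and> T \<subseteq> {v})" for T
      proof
        assume "triangle E T \<and> T \<subseteq> {v}"
        then have "T \<subseteq> {v}" "card T = 3" by (auto simp: triangle_def)
        then have "card {v} \<ge> 3" using card_mono[of "{v}" T] by simp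
        then show False by simp
      qed
      \<comment> \<open>A single vertex has potential exactly 3, so the account starts with
        \<open>I\<close> empty.\<close>
      ultimately have pc: "path_cover E {v} {} [[v]]"
        unfolding path_cover_def by (auto simp: potential_def is_end_def)
      have "\<exists>S I ps. path_cover E S I ps \<and> S \<subseteq> V \<and> S \<inter> set xs = {} \<and> v \<in> S \<and> triangle_closed E S"
        by (rule path_cover_grow[OF fin EV pos big less.prems(3) pc, where D = D]) (use v D in auto)
      then obtain S I ps where S: "path_cover E S I ps" "S \<subseteq> V" "S \<inter> set xs = {}" "v \<in> S"
        "triangle_closed E S"
        by blast
      \<comment> \<open>The order in which paths are joined is irrelevant: entries consecutive
        within a path stay consecutive, and every triangle lies in one class.\<close>
      define ys where "ys = xs @ concat ps"
      have Sps: "set (concat ps) = S" "distinct (concat ps)" using S by (auto simp: path_cover_def)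
      have setys: "set ys = set xs \<union> S" using Sps by (auto simp: ys_def)
      show ?thesis
      proof (rule less.hyps)
        have "card (set xs) < card (set ys)" "card (set ys) \<le> card V"
          using setys S v less.prems fin finite_subset[OF S(2) fin]
          by (auto intro!: psubset_card_mono card_mono)
        then show "card V - card (set ys) < card V - card (set xs)" by simp
        show "distinct ys" using Sps S less.prems by (auto simp: ys_def)
        show "set ys \<subseteq> V" using setys S less.prems by auto
        show "triangle_closed E (set ys)" using S(5) less.prems(3) unfolding setys triangle_closed_def by blast
        show "hits ys T" if T: "triangle E T" "T \<subseteq> set ys" for T
        proof (cases "T \<inter> S = {}")
          case True
          then have "hits xs T" using T setys by (intro less.prems) auto
          then show ?thesis using hits_append[of xs T "[]"] by (auto simp: ys_def)
        next
          case False
          then have "T \<subseteq> S" using S(5) T by (auto simp: triangle_closed_def)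
          then obtain p where p: "p \<in> set ps" "hits p T" using S(1) T unfolding path_cover_def by blast
          then obtain ps1 ps2 where "ps = ps1 @ p # ps2" by (meson split_list)
          then have "ys = (xs @ concat ps1) @ p @ concat ps2" by (simp add: ys_def)
          then show ?thesis using hits_append[OF p(2)] by metis
        qed
      qed
    qed
  qed
  from this[of "[]"] show ?thesis by (auto simp: triangle_closed_def triangle_def)
qed


section \<open>Labels from the ordering, and the coloured complete bipartite graph\<close>

lemma index_labelling:
  assumes "distinct xs"
  shows "\<exists>g. inj_on g (set xs) \<and> (\<forall>v\<in>set xs. g v < length xs) \<and>
    (\<forall>T. hits xs T \<longrightarrow> (\<exists>x\<in>T. \<exists>y\<in>T. g y = Suc (g x)))"
proof -
  \<comment> \<open>The label of a vertex is its position in the list, so neighbouring entries get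
    consecutive numbers.\<close>
  define g where "g = inv_into {..<length xs} ((!) xs)"
  have inj: "inj_on ((!) xs) {..<length xs}"
    using assms by (auto simp: inj_on_def nth_eq_iff_index_eq)
  have set: "set xs = (!) xs ` {..<length xs}"
    by (auto simp: set_conv_nth)
  have g: "g (xs ! i) = i" if "i < length xs" for i
    unfolding g_def using inj that by (intro inv_into_f_f) auto
  have "inj_on g (set xs)" unfolding g_def set by (rule inj_on_inv_into) simp
  moreover have "\<forall>v\<in>set xs. g v < length xs" using g by (auto simp: set)
  moreover have "\<exists>x\<in>T. \<exists>y\<in>T. g y = Suc (g x)" if hit: "hits xs T" for T
  proof -
    obtain us vs x y where xy: "x \<in> T" "y \<in> T" "xs = us @ x # y # vs"
      using hit unfolding hits_def by blast
    have "g x = length us" "g y = Suc (length us)"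
      using g[of "length us"] g[of "Suc (length us)"] xy(3) by (auto simp: nth_append)
    then show ?thesis using xy by (intro bexI[of _ x] bexI[of _ y]) auto
  qed
  ultimately show ?thesis by blast
qed

text \<open>The sides are initial and final segments of the vertex set, so in each edge
  \<open>Min\<close> is the left and \<open>Max\<close> the right end; the colouring reads off the
  sides in this way.\<close>

definition complete_bipartite :: "nat \<Rightarrow> nat \<Rightarrow> nat set set" where
  "complete_bipartite m n = {e. \<exists>l r. l < m \<and> m \<le> r \<and> r < n \<and> e = {l, r}}"

lemma complete_bipartite_subset: "complete_bipartite m n \<subseteq> all_pairs n"
  by (auto simp: complete_bipartite_def all_pairs_eq)

lemma doubleton_in_complete_bipartite:
  assumes "l < m" "m \<le> r"
  shows "{l, r} \<in> complete_bipartite m n \<longleftrightarrow> r < n"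
  using assms by (auto simp: complete_bipartite_def doubleton_eq_iff)

lemma card_complete_bipartite:
  assumes "m \<le> n"
  shows "card (complete_bipartite m n) = m * (n - m)"
proof -
  have "complete_bipartite m n = (\<lambda>(l, r). {l, r}) ` ({..<m} \<times> {m..<n})"
  proof (intro equalityI subsetI)
    fix e assume "e \<in> complete_bipartite m n"
    then obtain l r where "l < m" "m \<le> r" "r < n" "e = {l, r}" by (auto simp: complete_bipartite_def)
    then show "e \<in> (\<lambda>(l, r). {l, r}) ` ({..<m} \<times> {m..<n})"
      by (intro image_eqI[of _ _ "(l, r)"]) auto
  qed (auto simp: doubleton_in_complete_bipartite)
  moreover have "inj_on (\<lambda>(l, r). {l, r}) ({..<m} \<times> {m..<n})"
    by (auto simp: inj_on_def doubleton_eq_iff)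
  ultimately show ?thesis by (simp add: card_image)
qed

lemma complete_bipartite_not_rbw_K6:
  assumes R: "R \<subseteq> all_pairs n"
    and g: "inj_on g {..<n}" "\<And>v. v < n \<Longrightarrow> g v < n"
    and tri: "\<And>T. triangle R T \<Longrightarrow> \<exists>x\<in>T. \<exists>y\<in>T. g y = Suc (g x)"
    and K4: "\<And>S. card S = 4 \<Longrightarrow> \<not> pairs_of S \<subseteq> R"
  shows "\<not> rbw_K6 (complete_bipartite m n \<union> R)"
proof -
  let ?G = "complete_bipartite m n"
  \<comment> \<open>Adding \<open>n\<close> keeps the natural-number subtraction exact, since labels
    are below \<open>n\<close>. Bipartite edges get even colours; every other edge gets an odd
    colour of its own through \<open>set_encode\<close>.\<close>
  define c where "c = (\<lambda>e. if e \<in> ?G then 2 * (g (Min e) + n - g (Max e)) else 2 * set_encode e + 1)"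
  have c_cross: "c {l, r} = 2 * (g l + n - g r)" if "l < m" "m \<le> r" "r < n" for l r
    using that by (auto simp: c_def doubleton_in_complete_bipartite)
  have "proper_colouring (?G \<union> R) c"
    unfolding proper_colouring_def
  proof (intro ballI impI notI)
    fix e f assume ef: "e \<in> ?G \<union> R" "f \<in> ?G \<union> R" "e \<noteq> f \<and> e \<inter> f \<noteq> {}" and eq: "c e = c f"
    have fin: "finite e" "finite f"
      using ef R complete_bipartite_subset[of m n] by (auto simp: all_pairs_def)
    show False
    proof (cases "e \<in> ?G")
      case e: True
      show False
      proof (cases "f \<in> ?G")
        case True
        obtain l r where lr: "l < m" "m \<le> r" "r < n" "e = {l, r}" using e by (auto simp: complete_bipartite_def)
        obtain l' r' where lr': "l' < m" "m \<le> r'" "r' < n" "f = {l', r'}" using True by (auto simp: complete_bipartite_def)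
        have "g l + n - g r = g l' + n - g r'" using eq lr lr' c_cross by auto
        moreover have "g r < n" "g r' < n" using g lr lr' by auto
        ultimately have sum: "g l + g r' = g l' + g r" by linarith
        have "l = l' \<or> r = r'" using ef(3) lr lr' by auto
        then have "g l = g l' \<and> g r = g r'" using sum by auto
        then have "l = l' \<and> r = r'" using g(1) lr lr' by (auto simp: inj_on_def)
        then show False using ef(3) lr lr' by auto
      next
        case False
        then show False using eq e unfolding c_def by (simp, presburger)
      qed
    next
      case e: False
      show False
      proof (cases "f \<in> ?G")
        case True
        then show False using eq e unfolding c_def by (simp, presburger)
      next
        case False
        then show False using eq e ef(3) fin by (simp add: c_def set_encode_eq)
      qed
    qed
  qed
  moreover have "\<not> inj_on c (pairs_of S)" if S: "card S = 6" "pairs_of S \<subseteq> ?G \<union> R" for S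
  proof -
    have finS: "finite S" using S(1) by (simp add: card_ge_0_finite)
    define A where "A = {v \<in> S. v < m}"
    define B where "B = {v \<in> S. m \<le> v}"
    have "S = A \<union> B" "A \<inter> B = {}" "finite A" "finite B" using finS by (auto simp: A_def B_def)
    then have AB: "card A + card B = 6" using S(1) card_Un_disjoint by metis
    have "pairs_of A \<subseteq> R" "pairs_of B \<subseteq> R"
    proof -
      have "pairs_of A \<inter> ?G = {}" "pairs_of B \<inter> ?G = {}"
        by (auto simp: complete_bipartite_def A_def B_def)
      moreover have "pairs_of A \<subseteq> pairs_of S" "pairs_of B \<subseteq> pairs_of S"
        by (auto intro!: pairs_of_mono simp: A_def B_def)
      ultimately show "pairs_of A \<subseteq> R" "pairs_of B \<subseteq> R" using S(2) by blast+
    qed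
    note R_AB = this
    have small: "card X \<le> 3" if X: "pairs_of X \<subseteq> R" for X
    proof (rule ccontr)
      assume "\<not> card X \<le> 3"
      then have "4 \<le> card X" by simp
      then obtain Y where "Y \<subseteq> X" "card Y = 4" by (meson obtain_subset_with_card_n)
      then show False using K4 pairs_of_mono X by blast
    qed
    have "triangle R A" "triangle R B"
      using AB small[OF R_AB(1)] small[OF R_AB(2)] R_AB by (auto simp: triangle_def)
    then obtain x y x' y' where xy: "x \<in> A" "y \<in> A" "g y = Suc (g x)" "x' \<in> B" "y' \<in> B" "g y' = Suc (g x')"
      using tri by meson
    have lt: "x' < n" "y' < n"
    proof -
      have "triangle R B" by fact
      then have "B \<subseteq> {..<n}" using triangle_subset[of R B "{..<n}"] R by (simp add: all_pairs_eq)
      then show "x' < n" "y' < n" using xy by auto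
    qed
    have ord: "x < m" "y < m" "m \<le> x'" "m \<le> y'" using xy by (auto simp: A_def B_def)
    \<comment> \<open>Passing from \<open>x\<close> to \<open>y\<close> and from \<open>x'\<close>
      to \<open>y'\<close> raises both labels by one, which leaves their difference
      unchanged.\<close>
    have "c {x, x'} = c {y, y'}"
      using c_cross[of x x'] c_cross[of y y'] ord lt xy by simp
    moreover have "{x, x'} \<in> pairs_of S" "{y, y'} \<in> pairs_of S"
      using xy ord by (auto simp: A_def B_def)
    moreover have "{x, x'} \<noteq> {y, y'}" using xy ord by (auto simp: doubleton_eq_iff)
    ultimately show ?thesis unfolding inj_on_def by blast
  qed
  ultimately show ?thesis unfolding rbw_K6_def by blast
qed

text \<open>The balanced graph has n^2/4 edges, rounded down, which is at least half of all pairs;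
  hence the bound 1/2 on \<open>d\<close>.\<close>

lemma complete_bipartite_dense:
  assumes "d \<le> 1 / 2" "n \<ge> 2"
  shows "complete_bipartite (n div 2) n \<in> dense_family d n"
proof -
  define m where "m = n div 2"
  have "n * (n - 1) \<le> 4 * (m * (n - m))"
  proof (cases "even n")
    case True
    then obtain k where "n = 2 * k" by (elim evenE)
    then show ?thesis by (simp add: m_def algebra_simps)
  next
    case False
    then obtain k where "n = 2 * k + 1" by (elim oddE)
    then show ?thesis by (simp add: m_def algebra_simps)
  qed
  then have "n * (n - 1) div 2 \<le> 2 * (m * (n - m))" by linarith
  then have "n choose 2 \<le> 2 * card (complete_bipartite m n)"
    by (simp add: choose_two card_complete_bipartite m_def)
  then have "real (n choose 2) \<le> 2 * real (card (complete_bipartite m n))"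
    by (metis of_nat_le_iff of_nat_mult of_nat_numeral)
  moreover have "real (n choose 2) > 0" using assms by (simp add: zero_less_binomial_iff)
  ultimately have "edge_density n (complete_bipartite m n) \<ge> 1 / 2"
    unfolding edge_density_def by (simp add: field_simps)
  then show ?thesis using assms complete_bipartite_subset by (auto simp: dense_family_def m_def)
qed

section \<open>The lower bound on the threshold\<close>

text \<open>Union bound over a vertex set \<open>S\<close> together with a set \<open>F\<close> of
  exactly \<open>m\<close> pairs in it. The crude count 2^(k choose 2) for \<open>F\<close> suffices
  because it does not depend on \<open>n\<close>.\<close>

lemma gnp_prob_dense_spot_le:
  assumes p: "0 \<le> p" "p \<le> 1"
  shows "gnp_prob n p (\<lambda>R. \<exists>S\<subseteq>{..<n}. card S = k \<and> m \<le> card (edges_in R S))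
    \<le> real n ^ k * 2 ^ (k choose 2) * p ^ m"
proof -
  define I where "I = Sigma {S. S \<subseteq> {..<n} \<and> card S = k} (\<lambda>S. {F. F \<subseteq> pairs_of S \<and> card F = m})"
  have finS: "finite S" "finite {F. F \<subseteq> pairs_of S \<and> card F = m}" if "S \<subseteq> {..<n}" for S
    using finite_subset[OF that] by auto
  have finI: "finite I" unfolding I_def
    using finS by (intro finite_SigmaI) auto
  have "card I = (\<Sum>S | S \<subseteq> {..<n} \<and> card S = k. card {F. F \<subseteq> pairs_of S \<and> card F = m})"
    unfolding I_def using finS by (subst card_SigmaI) auto
  also have "\<dots> \<le> (\<Sum>S | S \<subseteq> {..<n} \<and> card S = k. 2 ^ (k choose 2))"
  proof (rule sum_mono)
    fix S assume "S \<in> {S. S \<subseteq> {..<n} \<and> card S = k}"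
    then have S: "finite S" "card S = k" using finS by auto
    have "card {F. F \<subseteq> pairs_of S \<and> card F = m} \<le> card (Pow (pairs_of S))"
      using S by (intro card_mono) auto
    also have "\<dots> = 2 ^ (k choose 2)" using S by (simp add: card_Pow card_pairs_of)
    finally show "card {F. F \<subseteq> pairs_of S \<and> card F = m} \<le> 2 ^ (k choose 2)" .
  qed
  also have "\<dots> = (n choose k) * 2 ^ (k choose 2)"
    by (simp add: n_subsets)
  also have "\<dots> \<le> n ^ k * 2 ^ (k choose 2)"
    using binomial_le_pow[of k n] by (intro mult_right_mono) (cases "k \<le> n", auto simp: binomial_eq_0)
  finally have "real (card I) \<le> real (n ^ k * 2 ^ (k choose 2))" by (simp only: of_nat_le_iff)
  then have cardI: "real (card I) \<le> real n ^ k * 2 ^ (k choose 2)" by simp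
  have "gnp_prob n p (\<lambda>R. \<exists>S\<subseteq>{..<n}. card S = k \<and> m \<le> card (edges_in R S))
      \<le> gnp_prob n p (\<lambda>R. \<exists>i\<in>I. snd i \<subseteq> R)"
  proof (intro gnp_prob_mono p)
    fix R assume "R \<subseteq> all_pairs n" "\<exists>S\<subseteq>{..<n}. card S = k \<and> m \<le> card (edges_in R S)"
    then obtain S where S: "S \<subseteq> {..<n}" "card S = k" "m \<le> card (edges_in R S)" by blast
    then obtain F where "F \<subseteq> edges_in R S" "card F = m" by (meson obtain_subset_with_card_n)
    then have "(S, F) \<in> I" "F \<subseteq> R" using S by (auto simp: I_def edges_in_def)
    then show "\<exists>i\<in>I. snd i \<subseteq> R" by force
  qed
  also have "\<dots> \<le> (\<Sum>i\<in>I. gnp_prob n p (\<lambda>R. snd i \<subseteq> R))"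
    using p finI by (intro gnp_prob_UN)
  also have "\<dots> = (\<Sum>i\<in>I. p ^ m)"
  proof (intro sum.cong refl)
    fix i assume i: "i \<in> I"
    then have "snd i \<subseteq> pairs_of (fst i)" "pairs_of (fst i) \<subseteq> pairs_of {..<n}" "card (snd i) = m"
      by (auto simp: I_def intro!: pairs_of_mono)
    then show "gnp_prob n p (\<lambda>R. snd i \<subseteq> R) = p ^ m"
      by (subst gnp_prob_subset) (auto simp: all_pairs_eq)
  qed
  also have "\<dots> \<le> real n ^ k * 2 ^ (k choose 2) * p ^ m"
    using cardI p by (simp add: mult_right_mono)
  finally show ?thesis .
qed

lemma powr_minus_le_1: "n \<ge> 1 \<Longrightarrow> a > 0 \<Longrightarrow> real n powr - a \<le> 1"
  by (auto simp: powr_minus inverse_le_1_iff ge_one_powr_ge_zero)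

lemma gnp_prob_dense_spot_tendsto:
  fixes a :: real
  assumes "a > 0" "real k < a * real m"
  shows "(\<lambda>n. gnp_prob n (real n powr - a) (\<lambda>R. \<exists>S\<subseteq>{..<n}. card S = k \<and> m \<le> card (edges_in R S)))
    \<longlonglongrightarrow> 0"
proof (rule tendsto_sandwich)
  have p: "0 \<le> real n powr - a" "real n powr - a \<le> 1" if "n \<ge> 1" for n
    using that assms powr_minus_le_1 by auto
  show "\<forall>\<^sub>F n in sequentially. 0 \<le> gnp_prob n (real n powr - a)
      (\<lambda>R. \<exists>S\<subseteq>{..<n}. card S = k \<and> m \<le> card (edges_in R S))"
    using eventually_ge_at_top[of 1] by eventually_elim (intro gnp_prob_nonneg p)
  show "\<forall>\<^sub>F n in sequentially. gnp_prob n (real n powr - a)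
      (\<lambda>R. \<exists>S\<subseteq>{..<n}. card S = k \<and> m \<le> card (edges_in R S))
      \<le> 2 ^ (k choose 2) * real n powr (real k - a * real m)"
    using eventually_ge_at_top[of 1]
  proof eventually_elim
    case (elim n)
    have eq: "real n ^ k * 2 ^ (k choose 2) * (real n powr - a) ^ m
        = 2 ^ (k choose 2) * real n powr (real k - a * real m)"
      using elim by (simp add: powr_diff powr_minus powr_realpow powr_powr[symmetric] field_simps)
    then show ?case using gnp_prob_dense_spot_le[OF p[OF elim], of n k m] by (simp only: eq)
  qed
  have "(\<lambda>n. real n powr (real k - a * real m)) \<longlonglongrightarrow> 0"
    using assms by (intro tendsto_neg_powr filterlim_real_sequentially) auto
  then show "(\<lambda>n. 2 ^ (k choose 2) * real n powr (real k - a * real m)) \<longlonglongrightarrow> 0"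
    using tendsto_mult_right_zero by blast
qed auto

text \<open>All that is asked of the random graph is the absence of \<open>k\<close>-sets with at
  least \<open>m\<close> edges for finitely many pairs (k, m). Each is absent with probability
  tending to 1, so \<open>D\<close> and the list \<open>K\<close> must be independent of
  \<open>n\<close>.\<close>

lemma threshold_lower:
  fixes d \<epsilon> :: real
  assumes d: "d \<le> 1 / 2" and \<epsilon>: "\<epsilon> > 0"
  shows "\<exists>G :: nat \<Rightarrow> nat set set. (\<forall>n\<ge>2. G n \<in> dense_family d n) \<and>
    ((\<lambda>n. gnp_prob n (real n powr (-(2/3 + \<epsilon>))) (\<lambda>R. \<not> rbw_K6 (G n \<union> R))) \<longlonglongrightarrow> 1)"
proof (intro exI[of _ "\<lambda>n. complete_bipartite (n div 2) n"] conjI)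
  show "\<forall>n\<ge>2. complete_bipartite (n div 2) n \<in> dense_family d n"
    using complete_bipartite_dense[OF d] by blast
  \<comment> \<open>Connected sparse structures are only excluded at large size: k vertices with 3(k
    - 1)/2 edges occur in expectation about n^(1 - 3\<epsilon>(k - 1)/2) times.
    \<open>D > 1 / \<epsilon>\<close> makes this exponent negative for k \<ge> D, and
    \<open>D \<ge> 4\<close> brings four-vertex sets within the bounded range.\<close>
  obtain D :: nat where D: "real D > 1 / \<epsilon>" "D \<ge> 4"
  proof -
    obtain D :: nat where D: "real D > 1 / \<epsilon>" using reals_Archimedean2 by blast
    show ?thesis by (rule that[of "max 4 D"]) (use D in auto)
  qed
  \<comment> \<open>The first family is 3k/2 rounded up, whose absence means potential at least 1.
    The second is 3(k - 1)/2 rounded up, whose absence means potential at least 4.\<close>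
  define K where "K = (\<lambda>k. (k, (3 * k + 1) div 2)) ` {1..Suc D} \<union> (\<lambda>k. (k, (3 * k - 2) div 2)) ` {D, Suc D}"
  define bad where "bad = (\<lambda>n R km. \<exists>S\<subseteq>{..<n}. card S = fst km \<and> snd km \<le> card (edges_in R S))"
  define p where "p = (\<lambda>n. real n powr (-(2/3 + \<epsilon>)))"
  have finK: "finite K" by (simp add: K_def)
  have p: "0 \<le> p n" "p n \<le> 1" if "n \<ge> 1" for n
    using that \<epsilon> powr_minus_le_1[of n "2/3 + \<epsilon>"] by (auto simp: p_def)
  have K: "real (fst km) < (2/3 + \<epsilon>) * real (snd km)" if "km \<in> K" for km
    using that unfolding K_def
  proof
    assume "km \<in> (\<lambda>k. (k, (3 * k + 1) div 2)) ` {1..Suc D}"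
    then obtain k where k: "km = (k, (3 * k + 1) div 2)" "k \<ge> 1" by auto
    then have "3 * k \<le> 2 * snd km" "snd km > 0" by auto
    then have "3 * real k \<le> 2 * real (snd km)" "\<epsilon> * real (snd km) > 0"
      using \<epsilon> by (linarith, simp)
    then show ?thesis using k(1) by (simp add: algebra_simps)
  next
    assume "km \<in> (\<lambda>k. (k, (3 * k - 2) div 2)) ` {D, Suc D}"
    then obtain k where k: "km = (k, (3 * k - 2) div 2)" "k \<ge> D" by auto
    then have "3 * k \<le> 2 * snd km + 3" "snd km \<ge> D" using D by auto
    then have "3 * real k \<le> 2 * real (snd km) + 3" "real (snd km) \<ge> real D" by linarith+
    moreover from this(2) have "\<epsilon> * real (snd km) \<ge> \<epsilon> * real D"
      using \<epsilon> by (intro mult_left_mono) auto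
    moreover have "\<epsilon> * real D > 1" using D(1) \<epsilon> by (simp add: field_simps)
    ultimately show ?thesis using k(1) by (simp add: algebra_simps)
  qed
  have good: "\<not> rbw_K6 (complete_bipartite (n div 2) n \<union> R)"
    if R: "R \<subseteq> all_pairs n" and nb: "\<not> (\<exists>km\<in>K. bad n R km)" for n R
  proof -
    have few: "card (edges_in R S) < m" if "S \<subseteq> {..<n}" "(card S, m) \<in> K" for S m
      using that nb unfolding bad_def by (metis fst_conv snd_conv not_le)
    have pos: "potential R S \<ge> 1" if S: "S \<subseteq> {..<n}" "S \<noteq> {}" "card S \<le> Suc D" for S
    proof -
      have "finite S" using S finite_subset by blast
      then have "card S \<ge> 1" using S by (simp add: Suc_le_eq card_gt_0_iff)
      then have "(card S, (3 * card S + 1) div 2) \<in> K" using S by (auto simp: K_def)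
      from few[OF S(1) this] show ?thesis by (simp add: potential_def)
    qed
    have big: "potential R S \<ge> 4" if S: "S \<subseteq> {..<n}" "card S = D \<or> card S = Suc D" for S
    proof -
      have "(card S, (3 * card S - 2) div 2) \<in> K" using S by (auto simp: K_def)
      from few[OF S(1) this] show ?thesis using S D by (auto simp: potential_def)
    qed
    have "\<exists>xs. distinct xs \<and> set xs = {..<n} \<and> (\<forall>T. triangle R T \<longrightarrow> hits xs T)"
      by (rule triangle_ordering[OF _ _ _ pos big, where D = D]) (use R D in \<open>auto simp: all_pairs_eq\<close>)
    then obtain xs where xs: "distinct xs" "set xs = {..<n}" "\<And>T. triangle R T \<Longrightarrow> hits xs T"
      by blast
    have len: "length xs = n" using xs(1,2) distinct_card by fastforce
    obtain g where g: "inj_on g {..<n}" "\<forall>v\<in>{..<n}. g v < n"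
      "\<forall>T. hits xs T \<longrightarrow> (\<exists>x\<in>T. \<exists>y\<in>T. g y = Suc (g x))"
      using index_labelling[OF xs(1)] unfolding xs(2) len by blast
    show ?thesis
    proof (rule complete_bipartite_not_rbw_K6[OF R g(1)])
      show "\<not> pairs_of S \<subseteq> R" if S: "card S = 4" for S
      proof
        assume *: "pairs_of S \<subseteq> R"
        then have "S \<subseteq> {..<n}"
          using subset_if_pairs_of_subset[of S "{..<n}"] R S by (auto simp: all_pairs_eq)
        \<comment> \<open>A complete graph on four vertices has potential 12 - 12 = 0.\<close>
        then have "potential R S \<ge> 1" using S D by (intro pos) auto
        moreover have "card (edges_in R S) = 6"
          using * S by (simp add: edges_in_def Int_absorb1 card_pairs_of card_ge_0_finite choose_two)
        ultimately show False using S by (simp add: potential_def)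
      qed
    qed (use g xs(3) in auto)
  qed
  have "(\<lambda>n. \<Sum>km\<in>K. gnp_prob n (p n) (\<lambda>R. bad n R km)) \<longlonglongrightarrow> (\<Sum>km\<in>K. 0)"
    unfolding p_def bad_def using \<epsilon> K by (intro tendsto_sum gnp_prob_dense_spot_tendsto) auto
  then have lim: "(\<lambda>n. 1 - (\<Sum>km\<in>K. gnp_prob n (p n) (\<lambda>R. bad n R km))) \<longlonglongrightarrow> 1 - 0"
    by (intro tendsto_diff tendsto_const) simp
  have "(\<lambda>n. gnp_prob n (p n) (\<lambda>R. \<not> rbw_K6 (complete_bipartite (n div 2) n \<union> R))) \<longlonglongrightarrow> 1"
  proof (rule tendsto_sandwich)
    show "\<forall>\<^sub>F n in sequentially. 1 - (\<Sum>km\<in>K. gnp_prob n (p n) (\<lambda>R. bad n R km))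
      \<le> gnp_prob n (p n) (\<lambda>R. \<not> rbw_K6 (complete_bipartite (n div 2) n \<union> R))"
      using eventually_ge_at_top[of 1]
    proof eventually_elim
      case (elim n)
      have "1 - (\<Sum>km\<in>K. gnp_prob n (p n) (\<lambda>R. bad n R km))
          \<le> 1 - gnp_prob n (p n) (\<lambda>R. \<exists>km\<in>K. bad n R km)"
        using gnp_prob_UN[OF p[OF elim] finK, of n "\<lambda>km R. bad n R km"] by simp
      also have "\<dots> = gnp_prob n (p n) (\<lambda>R. \<not> (\<exists>km\<in>K. bad n R km))"
        by (rule gnp_prob_compl[symmetric])
      also have "\<dots> \<le> gnp_prob n (p n) (\<lambda>R. \<not> rbw_K6 (complete_bipartite (n div 2) n \<union> R))"
        using p[OF elim] good by (intro gnp_prob_mono) auto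
      finally show ?case .
    qed
    show "\<forall>\<^sub>F n in sequentially.
      gnp_prob n (p n) (\<lambda>R. \<not> rbw_K6 (complete_bipartite (n div 2) n \<union> R)) \<le> 1"
      using eventually_ge_at_top[of 1]
      by eventually_elim (use gnp_prob_nonneg p in \<open>simp add: gnp_prob_compl\<close>)
  qed (use lim in auto)
  then show "(\<lambda>n. gnp_prob n (real n powr (-(2/3 + \<epsilon>)))
      (\<lambda>R. \<not> rbw_K6 (complete_bipartite (n div 2) n \<union> R))) \<longlonglongrightarrow> 1"
    by (simp only: p_def)
qed

section \<open>Counting non-rainbow pairs of triangles\<close>

lemma proper_colouring_inj:
  assumes "proper_colouring E c" "{v, w} \<in> E" "{v, w'} \<in> E" "c {v, w} = c {v, w'}"
  shows "w = w'"
proof (rule ccontr)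
  assume "w \<noteq> w'"
  then have "{v, w} \<noteq> {v, w'}" by (auto simp: doubleton_eq_iff)
  moreover have "{v, w} \<inter> {v, w'} \<noteq> {}" by auto
  ultimately show False
    using bspec[OF bspec[OF assms(1)[unfolded proper_colouring_def] assms(2)] assms(3)] assms(4) by simp
qed

lemma pairs_of_Un_subset:
  assumes "pairs_of T \<subseteq> E" "pairs_of B \<subseteq> E" "\<And>t b. t \<in> T \<Longrightarrow> b \<in> B \<Longrightarrow> {t, b} \<in> E"
  shows "pairs_of (T \<union> B) \<subseteq> E"
proof
  fix e assume "e \<in> pairs_of (T \<union> B)"
  then obtain x y where "e = {x, y}" "x \<in> T \<union> B" "y \<in> T \<union> B" "x \<noteq> y" by (auto simp: pairs_of_def)
  moreover have "{x, y} \<in> E" if "x \<in> X" "y \<in> X" "pairs_of X \<subseteq> E" "x \<noteq> y" for X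
    using that by (metis doubleton_in_pairs_of subsetD)
  moreover have "{x, y} = {y, x}" by (rule insert_commute)
  ultimately show "e \<in> E" using assms(1,2) assms(3)[of x y] assms(3)[of y x] by (metis Un_iff)
qed

text \<open>Two distinct edges of the same colour are disjoint, so they have four distinct ends, too
  many for one triangle. A split 3 + 1 gives an edge of a triangle and a crossing edge at its third
  vertex. A split 2 + 2 gives one edge in each triangle or two crossing edges.\<close>

lemma conflict_cases:
  assumes c: "proper_colouring E c" and T: "card T = 3" "pairs_of T \<subseteq> E" and B: "card B = 3" "pairs_of B \<subseteq> E"
    and TB: "\<And>t b. t \<in> T \<Longrightarrow> b \<in> B \<Longrightarrow> {t, b} \<in> E" and ni: "\<not> inj_on c (pairs_of (T \<union> B))"
  obtains (ef_TB) e f where "e \<in> pairs_of T" "f \<in> pairs_of B" "c e = c f"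
    | (e_T) e t b where "e \<in> pairs_of T" "t \<in> T" "t \<notin> e" "b \<in> B" "c e = c {t, b}"
    | (f_B) f t b where "f \<in> pairs_of B" "b \<in> B" "b \<notin> f" "t \<in> T" "c f = c {t, b}"
    | (crossing) t t' b b' where "t \<in> T" "t' \<in> T" "t \<noteq> t'" "b \<in> B" "b' \<in> B" "b \<noteq> b'" "c {t, b} = c {t', b'}"
proof -
  obtain e f where ef: "e \<in> pairs_of (T \<union> B)" "f \<in> pairs_of (T \<union> B)" "e \<noteq> f" "c e = c f"
    using ni unfolding inj_on_def by metis
  have sub: "pairs_of (T \<union> B) \<subseteq> E" by (rule pairs_of_Un_subset[OF T(2) B(2) TB])
  have "e \<in> E" "f \<in> E" using ef sub by auto
  then have disj: "e \<inter> f = {}" using c ef(3,4) unfolding proper_colouring_def by metis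
  obtain x y where e: "e = {x, y}" "x \<in> T \<union> B" "y \<in> T \<union> B" "x \<noteq> y" using ef(1) by (auto simp: pairs_of_def)
  obtain z w where f: "f = {z, w}" "z \<in> T \<union> B" "w \<in> T \<union> B" "z \<noteq> w" using ef(2) by (auto simp: pairs_of_def)
  have dist: "distinct [x, y, z, w]" using disj e f by auto
  have not4: "\<not> {x, y, z, w} \<subseteq> X" if X: "card X = 3" for X
  proof
    assume "{x, y, z, w} \<subseteq> X"
    then have "card {x, y, z, w} \<le> card X" using X by (intro card_mono) (auto intro: card_ge_0_finite)
    then show False using X dist by simp
  qed
  have col: "c {x, y} = c {z, w}" using ef e f by auto
  consider "{x, y, z, w} \<subseteq> T" | "{x, y, z, w} \<subseteq> B"
    | "x \<in> T" "y \<in> T" "z \<in> T" "w \<in> B" | "x \<in> T" "y \<in> T" "z \<in> B" "w \<in> T"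
    | "x \<in> T" "y \<in> B" "z \<in> T" "w \<in> T" | "x \<in> B" "y \<in> T" "z \<in> T" "w \<in> T"
    | "x \<in> B" "y \<in> B" "z \<in> B" "w \<in> T" | "x \<in> B" "y \<in> B" "z \<in> T" "w \<in> B"
    | "x \<in> B" "y \<in> T" "z \<in> B" "w \<in> B" | "x \<in> T" "y \<in> B" "z \<in> B" "w \<in> B"
    | "x \<in> T" "y \<in> T" "z \<in> B" "w \<in> B" | "x \<in> B" "y \<in> B" "z \<in> T" "w \<in> T"
    | "x \<in> T" "y \<in> B" "z \<in> T" "w \<in> B" | "x \<in> T" "y \<in> B" "z \<in> B" "w \<in> T"
    | "x \<in> B" "y \<in> T" "z \<in> T" "w \<in> B" | "x \<in> B" "y \<in> T" "z \<in> B" "w \<in> T"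
  proof -
    have "x \<in> T \<or> x \<in> B" "y \<in> T \<or> y \<in> B" "z \<in> T \<or> z \<in> B" "w \<in> T \<or> w \<in> B" using e f by auto
    then show thesis using that by (elim disjE) simp_all
  qed
  then show ?thesis
  proof cases
    case 1 then show ?thesis using not4[OF T(1)] by simp
  next
    case 2 then show ?thesis using not4[OF B(1)] by simp
  next
    case 3 then show ?thesis using dist col by (intro e_T[of "{x, y}" z w]) (auto simp: insert_commute)
  next
    case 4 then show ?thesis using dist col by (intro e_T[of "{x, y}" w z]) (auto simp: insert_commute)
  next
    case 5 then show ?thesis using dist col by (intro e_T[of "{z, w}" x y]) (auto simp: insert_commute)
  next
    case 6 then show ?thesis using dist col by (intro e_T[of "{z, w}" y x]) (auto simp: insert_commute)
  next
    case 7 then show ?thesis using dist col by (intro f_B[of "{x, y}" z w]) (auto simp: insert_commute)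
  next
    case 8 then show ?thesis using dist col by (intro f_B[of "{x, y}" w z]) (auto simp: insert_commute)
  next
    case 9 then show ?thesis using dist col by (intro f_B[of "{z, w}" x y]) (auto simp: insert_commute)
  next
    case 10 then show ?thesis using dist col by (intro f_B[of "{z, w}" y x]) (auto simp: insert_commute)
  next
    case 11 then show ?thesis using dist col by (intro ef_TB[of "{x, y}" "{z, w}"]) (auto simp: insert_commute)
  next
    case 12 then show ?thesis using dist col by (intro ef_TB[of "{z, w}" "{x, y}"]) (auto simp: insert_commute)
  next
    case 13 then show ?thesis using dist col by (intro crossing[of x z y w]) (auto simp: insert_commute)
  next
    case 14 then show ?thesis using dist col by (intro crossing[of x w y z]) (auto simp: insert_commute)
  next
    case 15 then show ?thesis using dist col by (intro crossing[of y z x w]) (auto simp: insert_commute)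
  next
    case 16 then show ?thesis using dist col by (intro crossing[of y w x z]) (auto simp: insert_commute)
  qed
qed

text \<open>The code is a relation rather than a function: each pair needs some code, and a code
  determines its pair, so no canonical choice of the conflicting edges has to be made.\<close>

lemma card_le_triple_code:
  assumes "finite Q" "\<And>T B. (T, B) \<in> A \<Longrightarrow> \<exists>x y z. (x, y, z) \<in> Q \<and> r T B x y z"
    and "\<And>T B T' B' x y z. (T, B) \<in> A \<Longrightarrow> (T', B') \<in> A \<Longrightarrow> r T B x y z \<Longrightarrow> r T' B' x y z
      \<Longrightarrow> T = T' \<and> B = B'"
  shows "card A \<le> card Q"
proof (rule card_le_if_inj_on_rel[OF assms(1),
      where r = "\<lambda>a q. r (fst a) (snd a) (fst q) (fst (snd q)) (snd (snd q))"])
  fix a assume "a \<in> A"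
  then obtain x y z where "(x, y, z) \<in> Q" "r (fst a) (snd a) x y z"
    using assms(2)[of "fst a" "snd a"] by auto
  then show "\<exists>q. q \<in> Q \<and> r (fst a) (snd a) (fst q) (fst (snd q)) (snd (snd q))"
    by (intro exI[of _ "(x, y, z)"]) simp
next
  fix a1 a2 q assume "a1 \<in> A" "a2 \<in> A"
    "r (fst a1) (snd a1) (fst q) (fst (snd q)) (snd (snd q))"
    "r (fst a2) (snd a2) (fst q) (fst (snd q)) (snd (snd q))"
  then show "a1 = a2"
    using assms(3)[of "fst a1" "snd a1" "fst a2" "snd a2"] by (simp add: prod_eq_iff)
qed

text \<open>An edge of a triangle is coded by the opposite vertex, one of three.\<close>

lemma pair_eq_Diff_singleton:
  assumes "card T = 3" "e \<in> pairs_of T"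
  obtains t where "t \<in> T" "e = T - {t}"
proof -
  have fin: "finite T" using assms by (auto intro: card_ge_0_finite)
  have e: "e \<subseteq> T" "card e = 2" using assms by (auto simp: pairs_of_eq)
  then have "card (T - e) = 1" using assms(1) fin finite_subset[OF e(1) fin] by (simp add: card_Diff_subset)
  then obtain t where "T - e = {t}" by (auto simp: card_1_singleton_iff)
  then have "t \<in> T" "e = T - {t}" using e(1) by auto
  then show ?thesis by (rule that)
qed

text \<open>For a fixed colouring, each non-rainbow pair can be recovered from one of its triangles, a bounded
  amount of information and one further vertex; so only \<open>O(n |\<B>|)\<close> pairs are not rainbow.\<close>

lemma ex_rainbow_pair:
  assumes c: "proper_colouring E c" and fin: "finite \<B>"
    and tri: "\<And>T. T \<in> \<B> \<Longrightarrow> triangle E T" "\<And>T. T \<in> \<B> \<Longrightarrow> T \<subseteq> {..<n}"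
    and lin: "\<And>T T'. T \<in> \<B> \<Longrightarrow> T' \<in> \<B> \<Longrightarrow> T \<noteq> T' \<Longrightarrow> card (T \<inter> T') \<le> 1"
    and P: "P \<subseteq> \<B> \<times> \<B>" "\<And>T B t b. (T, B) \<in> P \<Longrightarrow> t \<in> T \<Longrightarrow> b \<in> B \<Longrightarrow> {t, b} \<in> E"
    and big: "card P > 18 * n * card \<B>"
  shows "\<exists>(T, B)\<in>P. inj_on c (pairs_of (T \<union> B))"
proof (rule ccontr)
  assume neg: "\<not> ?thesis"
  have card3: "card T = 3" "pairs_of T \<subseteq> E" "finite T" if "T \<in> \<B>" for T
  proof -
    show "card T = 3" "pairs_of T \<subseteq> E" using tri(1)[OF that] by (simp_all add: triangle_def)
    then show "finite T" by (intro card_ge_0_finite) simp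
  qed
  have uniq: "T = T'" if "T \<in> \<B>" "T' \<in> \<B>" "v \<in> T" "w \<in> T" "v \<in> T'" "w \<in> T'" "v \<noteq> w" for T T' v w
  proof (rule ccontr)
    assume "T \<noteq> T'"
    then have "card (T \<inter> T') \<le> 1" by (intro lin that)
    moreover have "card {v, w} \<le> card (T \<inter> T')"
      using that card3(3)[OF that(1)] by (intro card_mono) auto
    ultimately show False using that by simp
  qed
  have other: "\<exists>v\<in>T. v \<noteq> b" if "T \<in> \<B>" for T b
  proof (rule ccontr)
    assume "\<not> ?thesis"
    then have "card T \<le> card {b}" by (intro card_mono) auto
    then show False using card3[OF that] by simp
  qed
  \<comment> \<open>A code stores one triangle, one or two of its vertices, and an arbitrary vertex.
    Three conflict types use \<open>Q\<close> and one uses \<open>Q'\<close>, so the total is (3 * 3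
    + 9) n |\<B>|: the origin of the constant 18.\<close>
  define Q where "Q = Sigma \<B> (\<lambda>T. T \<times> {..<n})"
  define Q' where "Q' = Sigma \<B> (\<lambda>T. (T \<times> T) \<times> {..<n})"
  have Q: "finite Q" "card Q = 3 * n * card \<B>"
    using fin card3 by (auto simp: Q_def card_SigmaI)
  have Q': "finite Q'" "card Q' = 9 * n * card \<B>"
    using fin card3 by (auto simp: Q'_def card_SigmaI card_cartesian_product)
  have E: "{v, w} \<in> E" if "T \<in> \<B>" "v \<in> T" "w \<in> T" "v \<noteq> w" for T v w
    by (rule subsetD[OF card3(2)[OF that(1)]]) (simp add: that)
  note inj = proper_colouring_inj[OF c]
  define A1 where "A1 = {(T, B) \<in> P. \<exists>e\<in>pairs_of T. \<exists>f\<in>pairs_of B. c e = c f}"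
  define A2 where "A2 = {(T, B) \<in> P. \<exists>e\<in>pairs_of T. \<exists>t\<in>T - e. \<exists>b\<in>B. c e = c {t, b}}"
  define A3 where "A3 = {(T, B) \<in> P. \<exists>f\<in>pairs_of B. \<exists>b\<in>B - f. \<exists>t\<in>T. c f = c {t, b}}"
  define A4 where "A4 = {(T, B) \<in> P. \<exists>t\<in>T. \<exists>t'\<in>T. \<exists>b\<in>B. \<exists>b'\<in>B. t \<noteq> t' \<and> b \<noteq> b' \<and> c {t, b} = c {t', b'}}"
  have PB: "T \<in> \<B>" "B \<in> \<B>" if "(T, B) \<in> P" for T B using that P(1) by auto
  have in_Q: "(T, t, v) \<in> Q" if "T \<in> \<B>" "t \<in> T" "B \<in> \<B>" "v \<in> B" for T t B v
    using that tri(2)[OF that(3)] by (auto simp: Q_def)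
  \<comment> \<open>Stored are \<open>T\<close>, an edge of it, and an end \<open>v\<close> of the
    equally coloured edge of \<open>B\<close>. Colour and \<open>v\<close> determine the other end,
    and two vertices determine \<open>B\<close>.\<close>
  have "card A1 \<le> card Q"
  proof (rule card_le_triple_code[OF Q(1), where
        r = "\<lambda>T B T' t v. T' = T \<and> v \<in> B \<and> (\<exists>w\<in>B. w \<noteq> v \<and> c (T - {t}) = c {v, w})"])
    fix T B assume "(T, B) \<in> A1"
    then obtain e f where a: "(T, B) \<in> P" "e \<in> pairs_of T" "f \<in> pairs_of B" "c e = c f"
      by (auto simp: A1_def)
    obtain t where t: "t \<in> T" "e = T - {t}"
      by (rule pair_eq_Diff_singleton[OF card3(1)[OF PB(1)[OF a(1)]] a(2)])
    obtain v w where f: "f = {v, w}" "v \<in> B" "w \<in> B" "v \<noteq> w" using a(3) by (auto simp: pairs_of_def)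
    have "(T, t, v) \<in> Q" using in_Q PB[OF a(1)] t(1) f(2) by simp
    moreover have "w \<noteq> v \<and> c (T - {t}) = c {v, w}" using a(4) f t by simp
    ultimately show "\<exists>T' t v. (T', t, v) \<in> Q \<and> T' = T \<and> v \<in> B \<and> (\<exists>w\<in>B. w \<noteq> v \<and> c (T - {t}) = c {v, w})"
      using f(2,3) by blast
  next
    fix T1 B1 T2 B2 T' t v assume A: "(T1, B1) \<in> A1" "(T2, B2) \<in> A1"
      and r: "T' = T1 \<and> v \<in> B1 \<and> (\<exists>w\<in>B1. w \<noteq> v \<and> c (T1 - {t}) = c {v, w})"
        "T' = T2 \<and> v \<in> B2 \<and> (\<exists>w\<in>B2. w \<noteq> v \<and> c (T2 - {t}) = c {v, w})"
    have P12: "(T1, B1) \<in> P" "(T2, B2) \<in> P" using A by (auto simp: A1_def)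
    note B12 = PB(2)[OF P12(1)] PB(2)[OF P12(2)]
    obtain w1 w2 where w: "w1 \<in> B1" "w1 \<noteq> v" "c (T1 - {t}) = c {v, w1}" "w2 \<in> B2" "w2 \<noteq> v" "c (T2 - {t}) = c {v, w2}"
      using r by blast
    have "w1 = w2"
      by (rule inj[of v]) (use w r E[OF B12(1)] E[OF B12(2)] in auto)
    then have "B1 = B2" using uniq[OF B12, of v w1] w r by auto
    then show "T1 = T2 \<and> B1 = B2" using r by simp
  qed
  \<comment> \<open>The colour of the edge opposite \<open>t\<close> determines the crossing edge at
    \<open>t\<close>, hence \<open>b\<close>; the stored \<open>v\<close> is a second vertex of
    \<open>B\<close>.\<close>
  moreover have "card A2 \<le> card Q"
  proof (rule card_le_triple_code[OF Q(1), where
        r = "\<lambda>T B T' t v. T' = T \<and> v \<in> B \<and> t \<in> T \<and> (\<exists>b\<in>B. b \<noteq> v \<and> c (T - {t}) = c {t, b})"])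
    fix T B assume "(T, B) \<in> A2"
    then obtain e t b where a: "(T, B) \<in> P" "e \<in> pairs_of T" "t \<in> T" "t \<notin> e" "b \<in> B" "c e = c {t, b}"
      by (auto simp: A2_def)
    have e: "e = T - {t}"
      by (rule pair_eq_Diff_singleton[OF card3(1)[OF PB(1)[OF a(1)]] a(2)]) (use a in auto)
    obtain v where v: "v \<in> B" "v \<noteq> b" using other[OF PB(2)[OF a(1)]] by blast
    have "(T, t, v) \<in> Q" using in_Q PB[OF a(1)] a(3) v(1) by simp
    moreover have "b \<noteq> v \<and> c (T - {t}) = c {t, b}" using a(6) e v by simp
    ultimately show "\<exists>T' t v. (T', t, v) \<in> Q \<and> T' = T \<and> v \<in> B \<and> t \<in> T \<and> (\<exists>b\<in>B. b \<noteq> v \<and> c (T - {t}) = c {t, b})"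
      using v(1) a(3,5) by blast
  next
    fix T1 B1 T2 B2 T' t v assume A: "(T1, B1) \<in> A2" "(T2, B2) \<in> A2"
      and r: "T' = T1 \<and> v \<in> B1 \<and> t \<in> T1 \<and> (\<exists>b\<in>B1. b \<noteq> v \<and> c (T1 - {t}) = c {t, b})"
        "T' = T2 \<and> v \<in> B2 \<and> t \<in> T2 \<and> (\<exists>b\<in>B2. b \<noteq> v \<and> c (T2 - {t}) = c {t, b})"
    have P12: "(T1, B1) \<in> P" "(T2, B2) \<in> P" using A by (auto simp: A2_def)
    obtain b1 b2 where b: "b1 \<in> B1" "b1 \<noteq> v" "c (T1 - {t}) = c {t, b1}" "b2 \<in> B2" "b2 \<noteq> v" "c (T2 - {t}) = c {t, b2}"
      using r by blast
    have "b1 = b2"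
      by (rule inj[of t]) (use b r P(2)[OF P12(1)] P(2)[OF P12(2)] in auto)
    then have "B1 = B2" using uniq[OF PB(2)[OF P12(1)] PB(2)[OF P12(2)], of v b1] b r by auto
    then show "T1 = T2 \<and> B1 = B2" using r by simp
  qed
  \<comment> \<open>The roles are exchanged: \<open>B\<close> is stored and \<open>T\<close> is
    recovered.\<close>
  moreover have "card A3 \<le> card Q"
  proof (rule card_le_triple_code[OF Q(1), where
        r = "\<lambda>T B B' b v. B' = B \<and> v \<in> T \<and> b \<in> B \<and> (\<exists>t\<in>T. t \<noteq> v \<and> c (B - {b}) = c {t, b})"])
    fix T B assume "(T, B) \<in> A3"
    then obtain f b t where a: "(T, B) \<in> P" "f \<in> pairs_of B" "b \<in> B" "b \<notin> f" "t \<in> T" "c f = c {t, b}"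
      by (auto simp: A3_def)
    have f: "f = B - {b}"
      by (rule pair_eq_Diff_singleton[OF card3(1)[OF PB(2)[OF a(1)]] a(2)]) (use a in auto)
    obtain v where v: "v \<in> T" "v \<noteq> t" using other[OF PB(1)[OF a(1)]] by blast
    have "(B, b, v) \<in> Q" using in_Q PB[OF a(1)] a(3) v(1) by simp
    moreover have "t \<noteq> v \<and> c (B - {b}) = c {t, b}" using a(6) f v by simp
    ultimately show "\<exists>B' b v. (B', b, v) \<in> Q \<and> B' = B \<and> v \<in> T \<and> b \<in> B \<and> (\<exists>t\<in>T. t \<noteq> v \<and> c (B - {b}) = c {t, b})"
      using v(1) a(3,5) by blast
  next
    fix T1 B1 T2 B2 B' b v assume A: "(T1, B1) \<in> A3" "(T2, B2) \<in> A3"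
      and r: "B' = B1 \<and> v \<in> T1 \<and> b \<in> B1 \<and> (\<exists>t\<in>T1. t \<noteq> v \<and> c (B1 - {b}) = c {t, b})"
        "B' = B2 \<and> v \<in> T2 \<and> b \<in> B2 \<and> (\<exists>t\<in>T2. t \<noteq> v \<and> c (B2 - {b}) = c {t, b})"
    have P12: "(T1, B1) \<in> P" "(T2, B2) \<in> P" using A by (auto simp: A3_def)
    obtain t1 t2 where t: "t1 \<in> T1" "t1 \<noteq> v" "c (B1 - {b}) = c {t1, b}" "t2 \<in> T2" "t2 \<noteq> v" "c (B2 - {b}) = c {t2, b}"
      using r by blast
    have "t1 = t2"
    proof (rule inj[of b])
      have "b \<in> B1" "b \<in> B2" "B1 = B2" using r by simp_all
      then have "{t1, b} \<in> E" "{t2, b} \<in> E" "c {t1, b} = c {t2, b}"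
        using P(2)[OF P12(1) t(1)] P(2)[OF P12(2) t(4)] t(3,6) by simp_all
      then show "{b, t1} \<in> E" "{b, t2} \<in> E" "c {b, t1} = c {b, t2}"
        by (simp_all add: insert_commute)
    qed
    then have "T1 = T2" using uniq[OF PB(1)[OF P12(1)] PB(1)[OF P12(2)], of v t1] t r by auto
    then show "T1 = T2 \<and> B1 = B2" using r by simp
  qed
  \<comment> \<open>From \<open>t\<close>, \<open>t'\<close> and \<open>b\<close> the colour of {t,
    b} is known; at \<open>t'\<close> it determines \<open>b'\<close>, and \<open>b\<close>,
    \<open>b'\<close> determine \<open>B\<close>.\<close>
  moreover have "card A4 \<le> card Q'"
  proof (rule card_le_triple_code[OF Q'(1), where
        r = "\<lambda>T B T' tt b. T' = T \<and> snd tt \<in> T \<and> b \<in> B \<and> (\<exists>b'\<in>B. b' \<noteq> b \<and> c {fst tt, b} = c {snd tt, b'})"])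
    fix T B assume "(T, B) \<in> A4"
    then obtain t t' b b' where a: "(T, B) \<in> P" "t \<in> T" "t' \<in> T" "b \<in> B" "b' \<in> B" "b \<noteq> b'" "c {t, b} = c {t', b'}"
      by (auto simp: A4_def)
    have "(T, (t, t'), b) \<in> Q'" using a(2-4) PB[OF a(1)] tri(2)[OF PB(2)[OF a(1)]] by (auto simp: Q'_def)
    moreover have "b' \<noteq> b \<and> c {fst (t, t'), b} = c {snd (t, t'), b'}" using a by simp
    moreover have "snd (t, t') \<in> T" using a by simp
    ultimately show "\<exists>T' tt b. (T', tt, b) \<in> Q' \<and> T' = T \<and> snd tt \<in> T \<and> b \<in> B \<and> (\<exists>b'\<in>B. b' \<noteq> b \<and> c {fst tt, b} = c {snd tt, b'})"
      using a(4,5) by blast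
  next
    fix T1 B1 T2 B2 T' tt b assume A: "(T1, B1) \<in> A4" "(T2, B2) \<in> A4"
      and r: "T' = T1 \<and> snd tt \<in> T1 \<and> b \<in> B1 \<and> (\<exists>b'\<in>B1. b' \<noteq> b \<and> c {fst tt, b} = c {snd tt, b'})"
        "T' = T2 \<and> snd tt \<in> T2 \<and> b \<in> B2 \<and> (\<exists>b'\<in>B2. b' \<noteq> b \<and> c {fst tt, b} = c {snd tt, b'})"
    have P12: "(T1, B1) \<in> P" "(T2, B2) \<in> P" using A by (auto simp: A4_def)
    obtain b1 b2 where b: "b1 \<in> B1" "b1 \<noteq> b" "c {fst tt, b} = c {snd tt, b1}"
      "b2 \<in> B2" "b2 \<noteq> b" "c {fst tt, b} = c {snd tt, b2}"
      using r by blast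
    have "b1 = b2"
      by (rule inj[of "snd tt"]) (use b r P(2)[OF P12(1)] P(2)[OF P12(2)] in auto)
    then have "B1 = B2" using uniq[OF PB(2)[OF P12(1)] PB(2)[OF P12(2)], of b b1] b r by auto
    then show "T1 = T2 \<and> B1 = B2" using r by simp
  qed
  moreover have "P \<subseteq> A1 \<union> A2 \<union> A3 \<union> A4"
  proof safe
    fix T B assume TB: "(T, B) \<in> P" and n: "(T, B) \<notin> A4" "(T, B) \<notin> A3" "(T, B) \<notin> A2"
    note T = card3(1,2)[OF PB(1)[OF TB]] and B = card3(1,2)[OF PB(2)[OF TB]]
    show "(T, B) \<in> A1"
    proof (rule conflict_cases[OF c T B P(2)[OF TB]])
      show "\<not> inj_on c (pairs_of (T \<union> B))" using neg TB by auto
      fix e f assume "e \<in> pairs_of T" "f \<in> pairs_of B" "c e = c f"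
      then show ?thesis using TB unfolding A1_def by blast
    next
      fix e t b assume "e \<in> pairs_of T" "t \<in> T" "t \<notin> e" "b \<in> B" "c e = c {t, b}"
      then have "(T, B) \<in> A2" using TB unfolding A2_def by blast
      then show ?thesis using n by simp
    next
      fix f t b assume "f \<in> pairs_of B" "b \<in> B" "b \<notin> f" "t \<in> T" "c f = c {t, b}"
      then have "(T, B) \<in> A3" using TB unfolding A3_def by blast
      then show ?thesis using n by simp
    next
      fix t t' b b' assume "t \<in> T" "t' \<in> T" "t \<noteq> t'" "b \<in> B" "b' \<in> B" "b \<noteq> b'" "c {t, b} = c {t', b'}"
      then have "(T, B) \<in> A4" using TB unfolding A4_def by blast
      then show ?thesis using n by simp
    qed
  qed
  moreover have "finite P" using P(1) fin finite_subset by blast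
  ultimately have "card P \<le> card (A1 \<union> A2 \<union> A3 \<union> A4)"
    by (intro card_mono) (auto simp: A1_def A2_def A3_def A4_def intro: finite_subset)
  also have "\<dots> \<le> card A1 + card A2 + card A3 + card A4"
    using card_Un_le[of "A1 \<union> A2 \<union> A3" A4] card_Un_le[of "A1 \<union> A2" A3] card_Un_le[of A1 A2] by linarith
  finally show False
    using \<open>card A1 \<le> card Q\<close> \<open>card A2 \<le> card Q\<close> \<open>card A3 \<le> card Q\<close> \<open>card A4 \<le> card Q'\<close> Q Q' big by linarith
qed

section \<open>Concentration of triangle counts\<close>

definition triples :: "nat set \<Rightarrow> nat set set" where
  "triples V = {T. T \<subseteq> V \<and> card T = 3}"

text \<open>Relative to a family because three counts are needed: over all triples, over those with
  many common neighbours, and over those inside one common neighbourhood.\<close>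

definition tri_count :: "nat set set \<Rightarrow> nat set set \<Rightarrow> nat" where
  "tri_count \<F> R = card {T \<in> \<F>. pairs_of T \<subseteq> R}"

lemma finite_triples [simp]: "finite V \<Longrightarrow> finite (triples V)"
  by (simp add: triples_def)

lemma card_triples: "finite V \<Longrightarrow> card (triples V) = card V choose 3"
  by (simp add: triples_def n_subsets)

lemma card_triples_lessThan_le: "card (triples {..<n}) \<le> n ^ 3"
  using binomial_le_pow[of 3 n] by (cases "3 \<le> n") (auto simp: card_triples binomial_eq_0)

lemma tripleD:
  assumes "T \<in> triples {..<n}"
  shows "card T = 3" "finite T" "T \<subseteq> {..<n}" "pairs_of T \<subseteq> all_pairs n" "card (pairs_of T) = 3"
proof -
  show T: "card T = 3" "T \<subseteq> {..<n}" using assms by (simp_all add: triples_def)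
  then show "finite T" by (simp add: card_ge_0_finite)
  then show "card (pairs_of T) = 3" using T by (simp add: card_pairs_of choose_two)
  show "pairs_of T \<subseteq> all_pairs n" unfolding all_pairs_eq by (rule pairs_of_mono) (rule T)
qed

lemma card_adjacent_triples:
  assumes "T \<in> triples {..<n}"
  shows "card {T' \<in> triples {..<n}. card (T \<inter> T') = 2} \<le> 3 * n"
proof -
  note T = tripleD[OF assms]
  have "{T' \<in> triples {..<n}. card (T \<inter> T') = 2} \<subseteq> (\<lambda>(t, v). insert v (T - {t})) ` (T \<times> {..<n})"
  proof
    fix T' assume "T' \<in> {T' \<in> triples {..<n}. card (T \<inter> T') = 2}"
    then have T': "T' \<in> triples {..<n}" and int: "card (T \<inter> T') = 2" by auto
    note T'' = tripleD[OF T']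
    have "card (T - T') = 1" using int T by (simp add: card_Diff_subset_Int)
    then obtain t where t: "T - T' = {t}" by (auto simp: card_1_singleton_iff)
    have "card (T' - T) = 1" using int T'' by (simp add: card_Diff_subset_Int Int_commute)
    then obtain v where v: "T' - T = {v}" by (auto simp: card_1_singleton_iff)
    have "T' = insert v (T - {t})" "t \<in> T" "v < n" using t v T''(3) by auto
    then show "T' \<in> (\<lambda>(t, v). insert v (T - {t})) ` (T \<times> {..<n})"
      by (intro image_eqI[of _ _ "(t, v)"]) auto
  qed
  then have "card {T' \<in> triples {..<n}. card (T \<inter> T') = 2} \<le> card ((\<lambda>(t, v). insert v (T - {t})) ` (T \<times> {..<n}))"
    using T by (intro card_mono) auto
  also have "\<dots> \<le> card (T \<times> {..<n})" using T by (intro card_image_le) auto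
  also have "\<dots> = 3 * n" using T by (simp add: card_cartesian_product)
  finally show ?thesis .
qed

text \<open>Inclusion-exclusion: the common edges are the pairs inside \<open>T \<inter> T'\<close>,
  so distinct triples share an edge only when they meet in two vertices.\<close>

lemma card_pairs_of_Un:
  assumes "T \<in> triples {..<n}" "T' \<in> triples {..<n}"
  shows "card (pairs_of T \<union> pairs_of T') = (if T = T' then 3 else if card (T \<inter> T') = 2 then 5 else 6)"
proof -
  note T = tripleD[OF assms(1)] and T' = tripleD[OF assms(2)]
  have un: "card (pairs_of T \<union> pairs_of T') + (card (T \<inter> T') choose 2) = 6"
    using card_Un_Int[of "pairs_of T" "pairs_of T'"] T T'
    by (simp add: pairs_of_Int[symmetric] card_pairs_of)
  have le: "card (T \<inter> T') \<le> 3" using card_mono[of T "T \<inter> T'"] T by auto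
  have "T = T'" if "card (T \<inter> T') = 3"
    using card_subset_eq[of T "T \<inter> T'"] card_subset_eq[of T' "T \<inter> T'"] T T' that by auto
  then consider "T = T'" | "T \<noteq> T'" "card (T \<inter> T') = 0" | "T \<noteq> T'" "card (T \<inter> T') = 1"
    | "T \<noteq> T'" "card (T \<inter> T') = 2"
    using le by linarith
  then show ?thesis using un T T' by cases (auto simp: choose_two)
qed

lemma tri_count_eq: "finite \<F> \<Longrightarrow> real (tri_count \<F> R) = (\<Sum>T\<in>\<F>. of_bool (pairs_of T \<subseteq> R))"
  by (simp add: tri_count_def sum.If_cases of_bool_def Int_def)

lemma gex_triangle_pair:
  assumes "T \<in> triples {..<n}" "T' \<in> triples {..<n}" 
  shows "gex (all_pairs n) p (\<lambda>R. of_bool (pairs_of T \<subseteq> R) * of_bool (pairs_of T' \<subseteq> R))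
    = p ^ card (pairs_of T \<union> pairs_of T')"
proof -
  have "gex (all_pairs n) p (\<lambda>R. of_bool (pairs_of T \<subseteq> R) * of_bool (pairs_of T' \<subseteq> R))
     = gex (all_pairs n) p (\<lambda>R. of_bool (pairs_of T \<union> pairs_of T' \<subseteq> R))"
    by (intro gex_cong) auto
  also have "\<dots> = p ^ card (pairs_of T \<union> pairs_of T')"
    using tripleD(4)[OF assms(1)] tripleD(4)[OF assms(2)] by (intro gex_subset) auto
  finally show ?thesis .
qed

lemma gex_tri_count:
  assumes "\<F> \<subseteq> triples {..<n}"
  shows "gex (all_pairs n) p (\<lambda>R. real (tri_count \<F> R)) = real (card \<F>) * p ^ 3"
proof -
  have fin: "finite \<F>" using assms finite_subset by (metis finite_lessThan finite_triples)
  have "gex (all_pairs n) p (\<lambda>R. real (tri_count \<F> R))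
      = (\<Sum>T\<in>\<F>. gex (all_pairs n) p (\<lambda>R. of_bool (pairs_of T \<subseteq> R)))"
    by (simp add: tri_count_eq[OF fin] gex_sum)
  also have "\<dots> = (\<Sum>T\<in>\<F>. p ^ 3)"
  proof (intro sum.cong refl)
    fix T assume "T \<in> \<F>"
    then have "T \<in> triples {..<n}" using assms by blast
    then show "gex (all_pairs n) p (\<lambda>R. of_bool (pairs_of T \<subseteq> R)) = p ^ 3"
      using tripleD(4,5) by (simp add: gex_subset)
  qed
  finally show ?thesis by simp
qed

text \<open>Triples without a common edge contribute p^6 each, which cancels against the squared
  mean. What remains is the diagonal and the at most 3n neighbours of each triple, whose unions have
  five edges.\<close>

lemma tri_count_variance:
  assumes \<F>: "\<F> \<subseteq> triples {..<n}" and p: "0 \<le> p" "p \<le> 1"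
  shows "gex (all_pairs n) p (\<lambda>R. (real (tri_count \<F> R) - real (card \<F>) * p ^ 3)\<^sup>2)
    \<le> real (card \<F>) * (p ^ 3 + 3 * real n * p ^ 5)"
proof -
  define \<mu> where "\<mu> = real (card \<F>) * p ^ 3"
  define X where "X = (\<lambda>R. real (tri_count \<F> R))"
  have fin: "finite \<F>" using \<F> finite_subset by (metis finite_lessThan finite_triples)
  have EX: "gex (all_pairs n) p X = \<mu>" unfolding X_def \<mu>_def by (rule gex_tri_count[OF \<F>])
  have "gex (all_pairs n) p (\<lambda>R. (X R)\<^sup>2)
      = (\<Sum>T\<in>\<F>. \<Sum>T'\<in>\<F>. gex (all_pairs n) p (\<lambda>R. of_bool (pairs_of T \<subseteq> R) * of_bool (pairs_of T' \<subseteq> R)))"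
    by (simp only: X_def tri_count_eq[OF fin] power2_eq_square sum_product gex_sum)
  also have "\<dots> \<le> (\<Sum>T\<in>\<F>. \<Sum>T'\<in>\<F>. p ^ 6 + of_bool (T = T') * p ^ 3 + of_bool (card (T \<inter> T') = 2) * p ^ 5)"
  proof (intro sum_mono)
    fix T T' assume "T \<in> \<F>" "T' \<in> \<F>"
    then have T: "T \<in> triples {..<n}" "T' \<in> triples {..<n}" using \<F> by auto
    show "gex (all_pairs n) p (\<lambda>R. of_bool (pairs_of T \<subseteq> R) * of_bool (pairs_of T' \<subseteq> R))
      \<le> p ^ 6 + of_bool (T = T') * p ^ 3 + of_bool (card (T \<inter> T') = 2) * p ^ 5"
      unfolding gex_triangle_pair[OF T] card_pairs_of_Un[OF T] using p by auto
  qed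
  also have "\<dots> \<le> (\<Sum>T\<in>\<F>. real (card \<F>) * p ^ 6 + p ^ 3 + real (3 * n) * p ^ 5)"
  proof (rule sum_mono)
    fix T assume T: "T \<in> \<F>"
    have "(\<Sum>T'\<in>\<F>. of_bool (T = T') * p ^ 3) = p ^ 3"
      using fin T by (simp add: sum_distrib_right[symmetric] of_bool_def)
    moreover have "(\<Sum>T'\<in>\<F>. of_bool (card (T \<inter> T') = 2) * p ^ 5)
        = real (card {T' \<in> \<F>. card (T \<inter> T') = 2}) * p ^ 5"
      using fin by (simp add: sum_distrib_right[symmetric] of_bool_def sum.If_cases Int_def)
    moreover have "card {T' \<in> \<F>. card (T \<inter> T') = 2} \<le> 3 * n"
    proof -
      have "card {T' \<in> \<F>. card (T \<inter> T') = 2} \<le> card {T' \<in> triples {..<n}. card (T \<inter> T') = 2}"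
        using \<F> by (intro card_mono) auto
      then show ?thesis using card_adjacent_triples[of T n] T \<F> by force
    qed
    then have "real (card {T' \<in> \<F>. card (T \<inter> T') = 2}) * p ^ 5 \<le> real (3 * n) * p ^ 5"
      using p by (intro mult_right_mono) (simp_all only: of_nat_le_iff zero_le_power)
    ultimately show "(\<Sum>T'\<in>\<F>. p ^ 6 + of_bool (T = T') * p ^ 3 + of_bool (card (T \<inter> T') = 2) * p ^ 5)
      \<le> real (card \<F>) * p ^ 6 + p ^ 3 + real (3 * n) * p ^ 5"
      by (simp add: sum.distrib)
  qed
  also have "\<dots> = \<mu>\<^sup>2 + real (card \<F>) * (p ^ 3 + 3 * real n * p ^ 5)"
    by (simp add: \<mu>_def power2_eq_square algebra_simps flip: power_add)
  finally have EX2: "gex (all_pairs n) p (\<lambda>R. (X R)\<^sup>2) \<le> \<mu>\<^sup>2 + real (card \<F>) * (p ^ 3 + 3 * real n * p ^ 5)" .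
  have "gex (all_pairs n) p (\<lambda>R. (X R - \<mu>)\<^sup>2)
      = gex (all_pairs n) p (\<lambda>R. (X R)\<^sup>2 - (2 * \<mu>) * X R + \<mu>\<^sup>2)"
    by (intro gex_cong) (simp add: power2_eq_square algebra_simps)
  also have "\<dots> = gex (all_pairs n) p (\<lambda>R. (X R)\<^sup>2) - \<mu>\<^sup>2"
    by (simp only: gex_add gex_diff gex_cmult EX gex_const finite_all_pairs) (simp add: power2_eq_square)
  finally show ?thesis using EX2 unfolding X_def \<mu>_def by linarith
qed

text \<open>Chebyshev's inequality. The hypothesis n p^2 \<le> 1 bounds the edge-sharing part of the
  variance by three times the diagonal part, hence the factor 1 + 3.\<close>

lemma tri_count_deviation:
  assumes \<F>: "\<F> \<subseteq> triples {..<n}" and p: "0 \<le> p" "p \<le> 1" "real n * p\<^sup>2 \<le> 1" and a: "a > 0"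
  shows "gnp_prob n p (\<lambda>R. \<bar>real (tri_count \<F> R) - real (card \<F>) * p ^ 3\<bar> \<ge> a)
    \<le> 4 * (real n ^ 3 * p ^ 3) / a\<^sup>2"
proof -
  let ?Y = "\<lambda>R. (real (tri_count \<F> R) - real (card \<F>) * p ^ 3)\<^sup>2"
  have "gnp_prob n p (\<lambda>R. \<bar>real (tri_count \<F> R) - real (card \<F>) * p ^ 3\<bar> \<ge> a)
      \<le> gnp_prob n p (\<lambda>R. ?Y R \<ge> a\<^sup>2)"
    using a by (intro gnp_prob_mono p(1,2)) (metis abs_le_square_iff abs_of_pos abs_abs)
  also have "\<dots> \<le> gex (all_pairs n) p ?Y / a\<^sup>2"
    unfolding gnp_prob_eq_gex using p a by (intro gex_markov) auto
  also have "\<dots> \<le> 4 * (real n ^ 3 * p ^ 3) / a\<^sup>2"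
  proof (rule divide_right_mono)
    have "gex (all_pairs n) p ?Y \<le> real (card \<F>) * (p ^ 3 + 3 * real n * p ^ 5)"
      using tri_count_variance[OF \<F> p(1,2)] .
    also have "\<dots> = real (card \<F>) * (p ^ 3 * (1 + 3 * (real n * p\<^sup>2)))"
      by (simp add: algebra_simps eval_nat_numeral)
    also have "\<dots> \<le> real n ^ 3 * (p ^ 3 * 4)"
    proof (intro mult_mono)
      have "card \<F> \<le> n ^ 3"
        using card_mono[OF _ \<F>] card_triples_lessThan_le[of n] by simp
      then show "real (card \<F>) \<le> real n ^ 3" by (metis of_nat_le_iff of_nat_power)
    qed (use p in auto)
    finally show "gex (all_pairs n) p ?Y \<le> 4 * (real n ^ 3 * p ^ 3)" by simp
  qed simp
  finally show ?thesis .
qed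

section \<open>Common neighbourhoods in dense graphs\<close>

definition common_nbrs :: "nat set set \<Rightarrow> nat \<Rightarrow> nat set \<Rightarrow> nat set" where
  "common_nbrs G n T = {w. w < n \<and> (\<forall>t\<in>T. {t, w} \<in> G)}"

lemma common_nbrs_subset: "common_nbrs G n T \<subseteq> {..<n}"
  by (auto simp: common_nbrs_def)

lemma finite_common_nbrs [simp]: "finite (common_nbrs G n T)"
  by (rule finite_subset[OF common_nbrs_subset]) simp

lemma disjoint_common_nbrs:
  assumes "G \<subseteq> all_pairs n"
  shows "T \<inter> common_nbrs G n T = {}"
  using assms by (fastforce simp: common_nbrs_def all_pairs_eq pairs_of_eq)

lemma card_edges_le_degree_sum:
  assumes "G \<subseteq> all_pairs n"
  shows "card G \<le> (\<Sum>w<n. card (nbrs G {..<n} w))"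
proof -
  have fin: "finite (nbrs G {..<n} w)" for w by (simp add: nbrs_def)
  have "G \<subseteq> (\<lambda>(w, v). {w, v}) ` Sigma {..<n} (nbrs G {..<n})"
  proof
    fix e assume e: "e \<in> G"
    then obtain u v where "u < n" "v < n" "e = {u, v}" using assms by (auto simp: all_pairs_def)
    then show "e \<in> (\<lambda>(w, v). {w, v}) ` Sigma {..<n} (nbrs G {..<n})"
      using e by (intro image_eqI[of _ _ "(u, v)"]) (auto simp: nbrs_def)
  qed
  then have "card G \<le> card ((\<lambda>(w, v). {w, v}) ` Sigma {..<n} (nbrs G {..<n}))"
    using fin by (intro card_mono) auto
  also have "\<dots> \<le> card (Sigma {..<n} (nbrs G {..<n}))" using fin by (intro card_image_le) auto
  also have "\<dots> = (\<Sum>w<n. card (nbrs G {..<n} w))" using fin by (simp add: card_SigmaI)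
  finally show ?thesis .
qed

lemma choose_3_ge: "k \<ge> 3 \<Longrightarrow> real (k choose 3) \<ge> (real k / 3) ^ 3"
  using binomial_ge_n_over_k_pow_k[of 3 k, where 'a = real] by simp

text \<open>Double counting of stars with three leaves, by the leaves and by the centre.\<close>

lemma sum_common_nbrs:
  "(\<Sum>T\<in>triples {..<n}. card (common_nbrs G n T)) = (\<Sum>w<n. card (nbrs G {..<n} w) choose 3)"
proof -
  have "(\<Sum>T\<in>triples {..<n}. card (common_nbrs G n T))
      = (\<Sum>T\<in>triples {..<n}. \<Sum>w<n. of_bool (\<forall>t\<in>T. {t, w} \<in> G))"
    by (intro sum.cong refl) (simp add: common_nbrs_def sum.If_cases of_bool_def Int_def)
  also have "\<dots> = (\<Sum>w<n. \<Sum>T\<in>triples {..<n}. of_bool (\<forall>t\<in>T. {t, w} \<in> G))"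
    by (rule sum.swap)
  also have "\<dots> = (\<Sum>w<n. card (triples (nbrs G {..<n} w)))"
  proof (intro sum.cong refl)
    fix w assume "w \<in> {..<n}"
    have "nbrs G {..<n} w = {t \<in> {..<n}. {t, w} \<in> G}"
      unfolding nbrs_def by (subst insert_commute) (rule refl)
    then have "triples (nbrs G {..<n} w) = {T \<in> triples {..<n}. \<forall>t\<in>T. {t, w} \<in> G}"
      by (simp add: triples_def subset_iff) blast
    then show "(\<Sum>T\<in>triples {..<n}. of_bool (\<forall>t\<in>T. {t, w} \<in> G)) = card (triples (nbrs G {..<n} w))"
      by (simp add: sum.If_cases of_bool_def Int_def)
  qed
  finally show ?thesis by (simp add: card_triples nbrs_def)
qed

text \<open>Dense graphs contain at least 2c n^4 stars with three leaves. Leaf sets with fewer than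
  c n centres account for at most c n^4 of them, and every other leaf set for at most n.\<close>

lemma many_good_triples:
  fixes d :: real
  assumes d: "0 < d" and n: "real n \<ge> 24 / d" "n \<ge> 2" and G: "G \<in> dense_family d n"
  defines "c \<equiv> d ^ 4 / 221184"
  shows "real (card {T \<in> triples {..<n}. c * real n \<le> real (card (common_nbrs G n T))}) \<ge> c * real n ^ 3"
proof -
  define deg where "deg = (\<lambda>w. card (nbrs G {..<n} w))"
  define A where "A = {w \<in> {..<n}. real (deg w) \<ge> d * real n / 8}"
  define \<F> where "\<F> = {T \<in> triples {..<n}. c * real n \<le> real (card (common_nbrs G n T))}"
  have c0: "c > 0" using d by (simp add: c_def)
  have GE: "G \<subseteq> all_pairs n" and dens: "d * real (n choose 2) \<le> real (card G)"
    using G n by (auto simp: dense_family_def edge_density_def field_simps zero_less_binomial_iff)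
  have deg_le: "deg w \<le> n" for w
    using card_mono[of "{..<n}" "nbrs G {..<n} w"] by (auto simp: deg_def nbrs_def)
  have "real (n choose 2) = real n * (real n - 1) / 2"
    using n by (simp add: choose_two real_of_nat_div of_nat_diff)
  also have "\<dots> \<ge> real n * (real n / 2) / 2"
    using n by (intro divide_right_mono mult_left_mono) auto
  finally have "d * (real n * real n / 4) \<le> d * real (n choose 2)"
    using d by (intro mult_left_mono) auto
  also have "\<dots> \<le> real (\<Sum>w<n. deg w)"
    using dens card_edges_le_degree_sum[OF GE] unfolding deg_def by linarith
  also have "\<dots> = (\<Sum>w\<in>A. real (deg w)) + (\<Sum>w\<in>{..<n} - A. real (deg w))"
    unfolding of_nat_sum by (subst sum.subset_diff[of A]) (auto simp: A_def)
  also have "\<dots> \<le> (\<Sum>w\<in>A. real n) + (\<Sum>w\<in>{..<n} - A. d * real n / 8)"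
    using deg_le by (intro add_mono sum_mono) (auto simp: A_def)
  also have "\<dots> \<le> real (card A) * real n + real n * (d * real n / 8)"
  proof -
    have "card ({..<n} - A) \<le> n" using card_mono[of "{..<n}" "{..<n} - A"] by auto
    then have "real (card ({..<n} - A)) * (d * real n / 8) \<le> real n * (d * real n / 8)"
      using d by (intro mult_right_mono) auto
    then show ?thesis by simp
  qed
  finally have "real n * (d * real n / 8) \<le> real n * real (card A)" by (simp add: algebra_simps)
  then have cardA: "d * real n / 8 \<le> real (card A)" using n by (simp add: mult_le_cancel_left_pos)
  have n24: "d * real n \<ge> 24" using n d by (simp add: field_simps)
  \<comment> \<open>At least dn/8 centres have degree at least dn/8 and so at least (dn/24)^3 stars
    each; 221184 is 2 * 8 * 24^3.\<close>
  have "2 * c * real n ^ 4 = (d * real n / 8) * (d * real n / 24) ^ 3"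
    by (simp add: c_def field_simps eval_nat_numeral)
  also have "\<dots> \<le> real (card A) * (d * real n / 24) ^ 3"
    using cardA d by (intro mult_right_mono) auto
  also have "\<dots> = (\<Sum>w\<in>A. (d * real n / 24) ^ 3)" by simp
  also have "\<dots> \<le> (\<Sum>w\<in>A. real (deg w choose 3))"
  proof (rule sum_mono)
    fix w assume w: "w \<in> A"
    then have dw: "d * real n / 8 \<le> real (deg w)" by (simp add: A_def)
    then have "deg w \<ge> 3" using n24 by linarith
    have "(d * real n / 24) ^ 3 \<le> (real (deg w) / 3) ^ 3"
      using dw d by (intro power_mono) auto
    then show "(d * real n / 24) ^ 3 \<le> real (deg w choose 3)"
      using choose_3_ge[OF \<open>deg w \<ge> 3\<close>] by linarith
  qed
  also have "\<dots> \<le> (\<Sum>w<n. real (deg w choose 3))"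
    by (intro sum_mono2) (auto simp: A_def)
  also have "\<dots> = (\<Sum>T\<in>triples {..<n}. real (card (common_nbrs G n T)))"
    using sum_common_nbrs[of G n] unfolding deg_def of_nat_sum[symmetric] by simp
  also have "\<dots> = (\<Sum>T\<in>\<F>. real (card (common_nbrs G n T))) + (\<Sum>T\<in>triples {..<n} - \<F>. real (card (common_nbrs G n T)))"
    by (subst sum.subset_diff[of \<F>]) (auto simp: \<F>_def)
  also have "\<dots> \<le> (\<Sum>T\<in>\<F>. real n) + (\<Sum>T\<in>triples {..<n} - \<F>. c * real n)"
  proof (intro add_mono sum_mono)
    show "real (card (common_nbrs G n T)) \<le> real n" for T
      using card_mono[OF _ common_nbrs_subset[of G n T]] by simp
  qed (auto simp: \<F>_def)
  also have "\<dots> \<le> real (card \<F>) * real n + real n ^ 3 * (c * real n)"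
  proof -
    have "card (triples {..<n} - \<F>) \<le> n ^ 3"
      using card_mono[of "triples {..<n}" "triples {..<n} - \<F>"] card_triples_lessThan_le[of n] by auto
    then have "real (card (triples {..<n} - \<F>)) \<le> real n ^ 3" by (metis of_nat_le_iff of_nat_power)
    then have "real (card (triples {..<n} - \<F>)) * (c * real n) \<le> real n ^ 3 * (c * real n)"
      using c0 by (intro mult_right_mono) auto
    then show ?thesis by simp
  qed
  finally have "real n * (c * real n ^ 3) \<le> real n * real (card \<F>)"
    by (simp add: algebra_simps eval_nat_numeral)
  then show ?thesis using n unfolding \<F>_def by (simp add: mult_le_cancel_left_pos)
qed

text \<open>The vertices of \<open>T\<close> are not among their common neighbours, so whether \<open>T\<close> is a triangle
  is independent of the triangles inside its common neighbourhood.\<close>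

lemma gnp_prob_triangle_indep:
  assumes T: "T \<in> triples {..<n}" and G: "G \<subseteq> all_pairs n" and \<F>: "\<F> \<subseteq> triples (common_nbrs G n T)"
  shows "gnp_prob n p (\<lambda>R. pairs_of T \<subseteq> R \<and> Q (tri_count \<F> R)) = p ^ 3 * gnp_prob n p (\<lambda>R. Q (tri_count \<F> R))"
proof -
  have *: "tri_count \<F> (insert e R) = tri_count \<F> R" if e: "e \<in> pairs_of T" for e R
  proof -
    have "pairs_of B \<subseteq> insert e R \<longleftrightarrow> pairs_of B \<subseteq> R" if "B \<in> \<F>" for B
    proof -
      have "T \<inter> B = {}" using disjoint_common_nbrs[OF G, of T] \<F> that by (auto simp: triples_def)
      then have "e \<notin> pairs_of B" using e pairs_of_Int[of T B] by (auto simp: pairs_of_def)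
      then show ?thesis by auto
    qed
    then have "{B \<in> \<F>. pairs_of B \<subseteq> insert e R} = {B \<in> \<F>. pairs_of B \<subseteq> R}" by blast
    then show ?thesis by (simp add: tri_count_def)
  qed
  have "gnp_prob n p (\<lambda>R. pairs_of T \<subseteq> R \<and> Q (tri_count \<F> R))
      = gex (all_pairs n) p (\<lambda>R. of_bool (pairs_of T \<subseteq> R) * of_bool (Q (tri_count \<F> R)))"
    unfolding gnp_prob_eq_gex by (intro gex_cong) auto
  also have "\<dots> = p ^ card (pairs_of T) * gex (all_pairs n) p (\<lambda>R. of_bool (Q (tri_count \<F> R)))"
    by (intro gex_subset_indep) (use tripleD(4)[OF T] * in auto)
  finally show ?thesis using tripleD(5)[OF T] by (simp add: gnp_prob_eq_gex)
qed

definition adjacent_triangles :: "nat \<Rightarrow> nat set set \<Rightarrow> (nat set \<times> nat set) set" where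
  "adjacent_triangles n R = {(T, T') \<in> triples {..<n} \<times> triples {..<n}.
    card (T \<inter> T') = 2 \<and> pairs_of T \<subseteq> R \<and> pairs_of T' \<subseteq> R}"

text \<open>Markov's inequality for at most 3n^4 ordered pairs with five edges each.\<close>

lemma gnp_prob_adjacent_triangles:
  assumes p: "0 \<le> p" "p \<le> 1" and a: "a > 0"
  shows "gnp_prob n p (\<lambda>R. real (card (adjacent_triangles n R)) \<ge> a) \<le> 3 * real n ^ 4 * p ^ 5 / a"
proof -
  let ?Z = "\<lambda>R. card (adjacent_triangles n R)"
  define I where "I = Sigma (triples {..<n}) (\<lambda>T. {T' \<in> triples {..<n}. card (T \<inter> T') = 2})"
  have finI: "finite I" by (auto simp: I_def)
  have "card I = (\<Sum>T\<in>triples {..<n}. card {T' \<in> triples {..<n}. card (T \<inter> T') = 2})"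
    by (auto simp: I_def card_SigmaI)
  also have "\<dots> \<le> (\<Sum>T\<in>triples {..<n}. 3 * n)"
    by (intro sum_mono card_adjacent_triples)
  also have "\<dots> \<le> n ^ 3 * (3 * n)" using card_triples_lessThan_le by simp
  finally have "real (card I) \<le> real (n ^ 3 * (3 * n))" by (simp only: of_nat_le_iff)
  then have cardI: "real (card I) \<le> 3 * real n ^ 4" by (simp add: eval_nat_numeral)
  have Z: "real (?Z R) = (\<Sum>i\<in>I. of_bool (pairs_of (fst i) \<subseteq> R) * of_bool (pairs_of (snd i) \<subseteq> R))" for R
  proof -
    have "?Z R = card {i \<in> I. pairs_of (fst i) \<subseteq> R \<and> pairs_of (snd i) \<subseteq> R}"
      unfolding adjacent_triangles_def I_def by (intro arg_cong[where f = card]) auto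
    also have "real \<dots> = (\<Sum>i\<in>I. of_bool (pairs_of (fst i) \<subseteq> R \<and> pairs_of (snd i) \<subseteq> R))"
      using finI by (simp add: sum.If_cases of_bool_def Int_def)
    also have "\<dots> = (\<Sum>i\<in>I. of_bool (pairs_of (fst i) \<subseteq> R) * of_bool (pairs_of (snd i) \<subseteq> R))"
      by (intro sum.cong) auto
    finally show ?thesis .
  qed
  have "gnp_prob n p (\<lambda>R. real (?Z R) \<ge> a) \<le> gex (all_pairs n) p (\<lambda>R. real (?Z R)) / a"
    unfolding gnp_prob_eq_gex using p a by (intro gex_markov) auto
  also have "gex (all_pairs n) p (\<lambda>R. real (?Z R)) = (\<Sum>i\<in>I. p ^ 5)"
    unfolding Z gex_sum
  proof (intro sum.cong refl)
    fix i assume i: "i \<in> I"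
    then have T: "fst i \<in> triples {..<n}" "snd i \<in> triples {..<n}" "card (fst i \<inter> snd i) = 2"
      by (auto simp: I_def)
    moreover have "fst i \<noteq> snd i" using T tripleD(1)[OF T(1)] by auto
    ultimately show "gex (all_pairs n) p (\<lambda>R. of_bool (pairs_of (fst i) \<subseteq> R) * of_bool (pairs_of (snd i) \<subseteq> R)) = p ^ 5"
      by (simp add: gex_triangle_pair card_pairs_of_Un)
  qed
  also have "\<dots> / a \<le> 3 * real n ^ 4 * p ^ 5 / a"
    using cardI p a by (intro divide_right_mono) (simp_all add: mult_right_mono)
  finally show ?thesis .
qed

section \<open>The upper bound on the threshold\<close>

lemma real_card_Diff_ge:
  assumes "finite B"
  shows "real (card A) - real (card B) \<le> real (card (A - B))"
proof -
  have "card A \<le> card (A - B) + card B" using diff_card_le_card_Diff[OF assms, of A] by linarith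
  then show ?thesis by linarith
qed

text \<open>The deterministic part. Of cq/2 triangles in \<open>\<F>\<close> at least (1/2 - 1/4 -
  1/8) cq survive the deletions, each with at least bq/2 partners, giving cbq^2/16 pairs. This must
  exceed 18n times the at most 2q triangles, hence 576 = 18 * 2 * 16.\<close>

lemma rbw_K6_if_typical:
  fixes q b c :: real
  assumes G: "G \<subseteq> all_pairs n" and pos: "c > 0" "b > 0" "q > 0" and \<F>: "\<F> \<subseteq> triples {..<n}"
    and all: "real (tri_count (triples {..<n}) R) \<le> 2 * q"
    and adj: "real (card (adjacent_triangles n R)) \<le> c / 8 * q" "real (card (adjacent_triangles n R)) \<le> b / 2 * q"
    and cnt: "c / 2 * q \<le> real (tri_count \<F> R)"
    and bad: "real (card {T \<in> \<F>. pairs_of T \<subseteq> R \<and> real (tri_count (triples (common_nbrs G n T)) R) \<le> b * q}) \<le> c / 4 * q"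
    and big: "c * b * q > 576 * real n"
  shows "rbw_K6 (G \<union> R)"
  unfolding rbw_K6_def
proof (intro allI impI)
  fix col assume col: "proper_colouring (G \<union> R) col"
  \<comment> \<open>The relation is symmetric, so its first components are all the triangles that
    share an edge with another one.\<close>
  define Adj where "Adj = fst ` adjacent_triangles n R"
  define \<B> where "\<B> = {T \<in> triples {..<n}. pairs_of T \<subseteq> R} - Adj"
  define Bad where "Bad = {T \<in> \<F>. pairs_of T \<subseteq> R \<and> real (tri_count (triples (common_nbrs G n T)) R) \<le> b * q}"
  define \<G> where "\<G> = {T \<in> \<F>. pairs_of T \<subseteq> R} - (Bad \<union> Adj)"
  define NB where "NB = (\<lambda>T. {B \<in> triples (common_nbrs G n T). pairs_of B \<subseteq> R} - Adj)"
  define P where "P = Sigma \<G> NB"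
  have fin: "finite \<F>" "finite Bad" using finite_subset[OF \<F>] by (auto simp: Bad_def)
  have "adjacent_triangles n R \<subseteq> triples {..<n} \<times> triples {..<n}"
    by (auto simp: adjacent_triangles_def)
  then have fin_adj: "finite (adjacent_triangles n R)" by (rule finite_subset) simp
  then have finAdj: "finite Adj" and cardAdj: "card Adj \<le> card (adjacent_triangles n R)"
    unfolding Adj_def by (auto intro: card_image_le)
  have fin\<G>: "finite \<G>" "finite \<B>" using fin by (auto simp: \<G>_def \<B>_def)
  have "real (tri_count \<F> R) - real (card (Bad \<union> Adj)) \<le> real (card \<G>)"
    unfolding \<G>_def tri_count_def using fin finAdj by (intro real_card_Diff_ge) auto
  moreover have "real (card (Bad \<union> Adj)) \<le> c / 4 * q + c / 8 * q"
    using card_Un_le[of Bad Adj] cardAdj adj(1) bad unfolding Bad_def[symmetric] by linarith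
  ultimately have card\<G>: "c / 8 * q \<le> real (card \<G>)" using cnt by linarith
  have cardNB: "b / 2 * q \<le> real (card (NB T))" if "T \<in> \<G>" for T
  proof -
    have "b * q < real (tri_count (triples (common_nbrs G n T)) R)"
      using that by (auto simp: \<G>_def Bad_def)
    moreover have "real (tri_count (triples (common_nbrs G n T)) R) - real (card Adj) \<le> real (card (NB T))"
      unfolding NB_def tri_count_def by (intro real_card_Diff_ge finAdj)
    moreover have "real (card Adj) \<le> b / 2 * q" using cardAdj adj(2) by linarith
    ultimately show ?thesis by (simp add: field_simps)
  qed
  have finNB: "finite (NB T)" for T by (simp add: NB_def)
  have "(c / 8 * q) * (b / 2 * q) \<le> real (card \<G>) * (b / 2 * q)"
    using card\<G> pos by (intro mult_right_mono) auto
  also have "\<dots> = (\<Sum>T\<in>\<G>. b / 2 * q)" by simp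
  also have "\<dots> \<le> (\<Sum>T\<in>\<G>. real (card (NB T)))" by (intro sum_mono cardNB)
  also have "\<dots> = real (card P)" using fin\<G> finNB by (simp add: P_def card_SigmaI)
  finally have cardP: "c * b * q * (q / 16) \<le> real (card P)" by (simp add: algebra_simps)
  have "card \<B> \<le> tri_count (triples {..<n}) R"
    unfolding \<B>_def tri_count_def by (intro card_mono) auto
  then have card\<B>: "real (card \<B>) \<le> 2 * q" using all by linarith
  have "real (18 * n * card \<B>) = 18 * real n * real (card \<B>)" by simp
  also have "\<dots> \<le> 18 * real n * (2 * q)"
    using card\<B> by (intro mult_left_mono) auto
  also have "\<dots> = 576 * real n * (q / 16)" by simp
  also have "\<dots> < c * b * q * (q / 16)" using big pos by (intro mult_strict_right_mono) auto
  also have "\<dots> \<le> real (card P)" by (rule cardP)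
  finally have card_big: "18 * n * card \<B> < card P" by (simp only: of_nat_less_iff)
  have P\<B>: "P \<subseteq> \<B> \<times> \<B>"
    using \<F> common_nbrs_subset[of G n] by (fastforce simp: P_def \<G>_def \<B>_def NB_def triples_def)
  have cross: "{t, b} \<in> G \<union> R" if "(T, B) \<in> P" "t \<in> T" "b \<in> B" for T B t b
    using that by (auto simp: P_def NB_def triples_def common_nbrs_def)
  have tri: "triangle (G \<union> R) T" "T \<subseteq> {..<n}" if "T \<in> \<B>" for T
    using that by (auto simp: \<B>_def triples_def triangle_def)
  have lin: "card (T \<inter> T') \<le> 1" if "T \<in> \<B>" "T' \<in> \<B>" "T \<noteq> T'" for T T'
  proof -
    have T: "T \<in> triples {..<n}" "T' \<in> triples {..<n}" using that by (auto simp: \<B>_def)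
    note T' = tripleD[OF T(1)] tripleD[OF T(2)]
    have "card (T \<inter> T') \<noteq> 2"
    proof
      assume "card (T \<inter> T') = 2"
      then have "(T, T') \<in> adjacent_triangles n R"
        using that by (auto simp: adjacent_triangles_def \<B>_def)
      then have "T \<in> Adj" by (force simp: Adj_def)
      then show False using that by (simp add: \<B>_def)
    qed
    moreover have "card (T \<inter> T') \<noteq> 3"
      using card_subset_eq[of T "T \<inter> T'"] card_subset_eq[of T' "T \<inter> T'"] T' that(3) by auto
    moreover have "card (T \<inter> T') \<le> 3" using card_mono[of T "T \<inter> T'"] T' by auto
    ultimately show ?thesis by linarith
  qed
  have "\<exists>(T, B)\<in>P. inj_on col (pairs_of (T \<union> B))"
    by (rule ex_rainbow_pair[OF col fin\<G>(2) tri lin P\<B> cross card_big])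
  then obtain T B where TB: "(T, B) \<in> P" "inj_on col (pairs_of (T \<union> B))" by blast
  have in\<B>: "T \<in> \<B>" "B \<in> \<B>" using P\<B> TB by auto
  then have "card T = 3" "card B = 3" by (auto simp: \<B>_def triples_def)
  moreover have "T \<inter> B = {}"
    using TB(1) disjoint_common_nbrs[OF G, of T] by (auto simp: P_def NB_def triples_def)
  ultimately have "card (T \<union> B) = 6"
    by (subst card_Un_disjoint) (auto intro: card_ge_0_finite)
  moreover have "pairs_of (T \<union> B) \<subseteq> G \<union> R"
    using tri(1)[OF in\<B>(1)] tri(1)[OF in\<B>(2)] cross[OF TB(1)]
    by (intro pairs_of_Un_subset) (auto simp: triangle_def)
  ultimately show "\<exists>S. card S = 6 \<and> pairs_of S \<subseteq> G \<union> R \<and> inj_on col (pairs_of S)"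
    using TB(2) by blast
qed

text \<open>The summands bound, in order, a deviation of the number of all triangles, one of those
  in \<open>\<F>\<close>, an excess of triangles with a poor common neighbourhood, and an excess of
  edge-sharing pairs. The number 2bq is a lower bound for the mean count inside a common
  neighbourhood of size at least cn.\<close>

lemma gnp_prob_not_rbw_K6_le:
  fixes c p :: real
  assumes G: "G \<subseteq> all_pairs n" and p: "0 \<le> p" "p \<le> 1" "real n * p\<^sup>2 \<le> 1"
    and c: "c > 0" "c * real n \<ge> 3"
  defines "\<F> \<equiv> {T \<in> triples {..<n}. c * real n \<le> real (card (common_nbrs G n T))}"
    and "q \<equiv> real n ^ 3 * p ^ 3" and "b \<equiv> (c / 3) ^ 3 / 2"
  assumes card\<F>: "c * real n ^ 3 \<le> real (card \<F>)" and q: "q > 0" and big: "c * b * q > 576 * real n"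
  shows "gnp_prob n p (\<lambda>R. \<not> rbw_K6 (G \<union> R))
    \<le> 4 / q + 16 / (c\<^sup>2 * q) + 16 / (b\<^sup>2 * c * q) + 3 * (real n * p\<^sup>2) / min (c / 8) (b / 2)"
proof -
  \<comment> \<open>One bound on the edge-sharing pairs must serve both the loss among
    \<open>T\<close> and the loss among its partners.\<close>
  define \<eta> where "\<eta> = min (c / 8) (b / 2)"
  define N where "N = (\<lambda>T. triples (common_nbrs G n T))"
  define bad where "bad = (\<lambda>R. card {T \<in> \<F>. pairs_of T \<subseteq> R \<and> real (tri_count (N T) R) \<le> b * q})"
  let ?dev = "\<lambda>\<F> a R. \<bar>real (tri_count \<F> R) - real (card \<F>) * p ^ 3\<bar> \<ge> a"
  have b0: "b > 0" using c by (simp add: b_def)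
  have \<eta>: "\<eta> > 0" "\<eta> \<le> c / 8" "\<eta> \<le> b / 2" using c b0 by (auto simp: \<eta>_def)
  have \<F>_sub: "\<F> \<subseteq> triples {..<n}" by (auto simp: \<F>_def)
  have fin\<F>: "finite \<F>" using finite_subset[OF \<F>_sub] by simp
  have N_sub: "N T \<subseteq> triples {..<n}" for T
    using common_nbrs_subset[of G n T] by (auto simp: N_def triples_def)
  have card_le: "real (card \<A>) \<le> real n ^ 3" if "\<A> \<subseteq> triples {..<n}" for \<A>
  proof -
    have "card \<A> \<le> n ^ 3" using card_mono[OF _ that] card_triples_lessThan_le[of n] by simp
    then show ?thesis by (metis of_nat_le_iff of_nat_power)
  qed
  have dev: "gnp_prob n p (?dev \<A> (a * q)) \<le> 4 / (a\<^sup>2 * q)" if "\<A> \<subseteq> triples {..<n}" "a > 0" for \<A> a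
  proof -
    have "gnp_prob n p (?dev \<A> (a * q)) \<le> 4 * (real n ^ 3 * p ^ 3) / (a * q)\<^sup>2"
      by (rule tri_count_deviation[OF that(1) p]) (use that q in auto)
    also have "\<dots> = 4 / (a\<^sup>2 * q)"
      unfolding q_def[symmetric] using q by (simp add: power2_eq_square)
    finally show ?thesis .
  qed
  have N_low: "gnp_prob n p (\<lambda>R. real (tri_count (N T) R) \<le> b * q) \<le> 4 / (b\<^sup>2 * q)" if T: "T \<in> \<F>" for T
  proof -
    have k: "c * real n \<le> real (card (common_nbrs G n T))" using T by (simp add: \<F>_def)
    then have "3 \<le> card (common_nbrs G n T)" using c by linarith
    have "(c * real n / 3) ^ 3 \<le> (real (card (common_nbrs G n T)) / 3) ^ 3"
      using k c by (intro power_mono) auto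
    also have "\<dots> \<le> real (card (N T))"
      using choose_3_ge[OF \<open>3 \<le> card (common_nbrs G n T)\<close>] by (simp add: N_def card_triples)
    finally have "(c * real n / 3) ^ 3 * p ^ 3 \<le> real (card (N T)) * p ^ 3"
      using p by (intro mult_right_mono) auto
    moreover have "(c * real n / 3) ^ 3 * p ^ 3 = 2 * b * q"
      by (simp add: b_def q_def power_mult_distrib power_divide)
    ultimately have "gnp_prob n p (\<lambda>R. real (tri_count (N T) R) \<le> b * q) \<le> gnp_prob n p (?dev (N T) (b * q))"
      by (intro gnp_prob_mono p(1,2)) (auto simp: algebra_simps)
    also have "\<dots> \<le> 4 / (b\<^sup>2 * q)" using dev[OF N_sub b0] .
    finally show ?thesis .
  qed
  \<comment> \<open>By independence the expected number of bad triangles is at most q times 4/(b^2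
    q), a constant, whereas cq/4 are allowed.\<close>
  have bad_prob: "gnp_prob n p (\<lambda>R. real (bad R) \<ge> c / 4 * q) \<le> 16 / (b\<^sup>2 * c * q)"
  proof -
    have bad_eq: "real (bad R) = (\<Sum>T\<in>\<F>. of_bool (pairs_of T \<subseteq> R \<and> real (tri_count (N T) R) \<le> b * q))" for R
      using fin\<F> by (simp add: bad_def sum.If_cases of_bool_def Int_def)
    have "gex (all_pairs n) p (\<lambda>R. real (bad R))
        = (\<Sum>T\<in>\<F>. gnp_prob n p (\<lambda>R. pairs_of T \<subseteq> R \<and> real (tri_count (N T) R) \<le> b * q))"
      unfolding bad_eq gex_sum gnp_prob_eq_gex ..
    also have "\<dots> \<le> (\<Sum>T\<in>\<F>. p ^ 3 * (4 / (b\<^sup>2 * q)))"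
    proof (rule sum_mono)
      fix T assume T: "T \<in> \<F>"
      have "gnp_prob n p (\<lambda>R. pairs_of T \<subseteq> R \<and> real (tri_count (N T) R) \<le> b * q)
          = p ^ 3 * gnp_prob n p (\<lambda>R. real (tri_count (N T) R) \<le> b * q)"
        using T \<F>_sub G by (intro gnp_prob_triangle_indep[where Q = "\<lambda>k. real k \<le> b * q"]) (auto simp: N_def)
      then show "gnp_prob n p (\<lambda>R. pairs_of T \<subseteq> R \<and> real (tri_count (N T) R) \<le> b * q)
          \<le> p ^ 3 * (4 / (b\<^sup>2 * q))"
        using mult_left_mono[OF N_low[OF T], of "p ^ 3"] p by (simp only: zero_le_power)
    qed
    also have "\<dots> = real (card \<F>) * (p ^ 3 * (4 / (b\<^sup>2 * q)))" by simp
    also have "\<dots> \<le> real n ^ 3 * (p ^ 3 * (4 / (b\<^sup>2 * q)))"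
      using card_le[OF \<F>_sub] p q by (intro mult_right_mono) auto
    also have "\<dots> = q * (4 / (b\<^sup>2 * q))" by (simp add: q_def)
    also have "\<dots> = 4 / b\<^sup>2" using q by simp
    finally have ex: "gex (all_pairs n) p (\<lambda>R. real (bad R)) \<le> 4 / b\<^sup>2" .
    have "gnp_prob n p (\<lambda>R. real (bad R) \<ge> c / 4 * q) \<le> gex (all_pairs n) p (\<lambda>R. real (bad R)) / (c / 4 * q)"
      unfolding gnp_prob_eq_gex using p c q by (intro gex_markov) auto
    also have "\<dots> \<le> (4 / b\<^sup>2) / (c / 4 * q)" using ex c q by (intro divide_right_mono) auto
    also have "\<dots> = 16 / (b\<^sup>2 * c * q)" by (simp add: field_simps)
    finally show ?thesis .
  qed
  have adj_prob: "gnp_prob n p (\<lambda>R. real (card (adjacent_triangles n R)) \<ge> \<eta> * q) \<le> 3 * (real n * p\<^sup>2) / \<eta>"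
  proof -
    have "gnp_prob n p (\<lambda>R. real (card (adjacent_triangles n R)) \<ge> \<eta> * q) \<le> 3 * real n ^ 4 * p ^ 5 / (\<eta> * q)"
      using p \<eta> q by (intro gnp_prob_adjacent_triangles) auto
    also have "3 * real n ^ 4 * p ^ 5 = q * (3 * (real n * p\<^sup>2))"
      by (simp add: q_def eval_nat_numeral)
    also have "\<dots> / (\<eta> * q) = 3 * (real n * p\<^sup>2) / \<eta>" using q by simp
    finally show ?thesis .
  qed
  have good: "rbw_K6 (G \<union> R)"
    if "\<not> ?dev (triples {..<n}) (1 * q) R" "\<not> ?dev \<F> (c / 2 * q) R" "\<not> real (bad R) \<ge> c / 4 * q"
      "\<not> real (card (adjacent_triangles n R)) \<ge> \<eta> * q" for R
  proof (rule rbw_K6_if_typical[OF G c(1) b0 q \<F>_sub _ _ _ _ _ big])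
    have "real (card (triples {..<n})) * p ^ 3 \<le> q"
      unfolding q_def using card_le[of "triples {..<n}"] p by (intro mult_right_mono) auto
    then show "real (tri_count (triples {..<n}) R) \<le> 2 * q" using that(1) by linarith
    have "c * q \<le> real (card \<F>) * p ^ 3"
      unfolding q_def using mult_right_mono[OF card\<F>, of "p ^ 3"] p by (simp add: mult.assoc)
    moreover have "real (card \<F>) * p ^ 3 - real (tri_count \<F> R) < c * q / 2"
      using that(2) abs_ge_minus_self[of "real (tri_count \<F> R) - real (card \<F>) * p ^ 3"] by simp
    ultimately show "c / 2 * q \<le> real (tri_count \<F> R)" by simp
    have "\<eta> * q \<le> c / 8 * q" "\<eta> * q \<le> b / 2 * q"
      using \<eta> q by (auto intro!: mult_right_mono simp del: times_divide_eq_left)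
    then show "real (card (adjacent_triangles n R)) \<le> c / 8 * q" "real (card (adjacent_triangles n R)) \<le> b / 2 * q"
      using that(4) by linarith+
    show "real (card {T \<in> \<F>. pairs_of T \<subseteq> R \<and> real (tri_count (triples (common_nbrs G n T)) R) \<le> b * q}) \<le> c / 4 * q"
      using that(3) unfolding bad_def N_def by linarith
  qed
  have "gnp_prob n p (\<lambda>R. \<not> rbw_K6 (G \<union> R)) \<le> gnp_prob n p (\<lambda>R. ?dev (triples {..<n}) (1 * q) R \<or>
      ?dev \<F> (c / 2 * q) R \<or> real (bad R) \<ge> c / 4 * q \<or> real (card (adjacent_triangles n R)) \<ge> \<eta> * q)"
    using good by (intro gnp_prob_mono p(1,2)) blast
  also have "\<dots> \<le> gnp_prob n p (?dev (triples {..<n}) (1 * q)) + (gnp_prob n p (?dev \<F> (c / 2 * q))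
      + (gnp_prob n p (\<lambda>R. real (bad R) \<ge> c / 4 * q)
      + gnp_prob n p (\<lambda>R. real (card (adjacent_triangles n R)) \<ge> \<eta> * q)))"
    by (intro order.trans[OF gnp_prob_disj[OF p(1,2)]] add_left_mono order.refl)
  also have "\<dots> \<le> 4 / (1\<^sup>2 * q) + (4 / ((c / 2)\<^sup>2 * q) + (16 / (b\<^sup>2 * c * q) + 3 * (real n * p\<^sup>2) / \<eta>))"
    using dev[of "triples {..<n}" 1] dev[OF \<F>_sub, of "c / 2"] c bad_prob adj_prob
    by (intro add_mono) auto
  also have "\<dots> = 4 / q + 16 / (c\<^sup>2 * q) + 16 / (b\<^sup>2 * c * q) + 3 * (real n * p\<^sup>2) / \<eta>"
    by (simp add: power2_eq_square)
  finally show ?thesis unfolding \<eta>_def .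
qed

lemma threshold_upper:
  fixes d :: real and p :: "nat \<Rightarrow> real"
  assumes d: "0 < d" and p: "\<And>n. 0 \<le> p n \<and> p n \<le> 1"
    and lim: "filterlim (\<lambda>n. p n / real n powr (-(2/3))) at_top sequentially"
    and G: "\<And>n. n \<ge> 2 \<Longrightarrow> G n \<in> dense_family d n"
  shows "(\<lambda>n. gnp_prob n (p n) (\<lambda>R. rbw_K6 (G n \<union> R))) \<longlonglongrightarrow> 1"
proof -
  \<comment> \<open>The exponent -3/5 lies between -2/3 and -1/2: above the threshold by n^(1/15),
    yet n r^2 is at most n^(-1/5).\<close>
  define r where "r = (\<lambda>n. min (p n) (real n powr (-(3/5))))"
  define q where "q = (\<lambda>n. real n ^ 3 * r n ^ 3)"
  define c where "c = d ^ 4 / 221184"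
  define b where "b = (c / 3) ^ 3 / 2"
  define err where "err = (\<lambda>n. 4 / q n + 16 / (c\<^sup>2 * q n) + 16 / (b\<^sup>2 * c * q n)
      + 3 * (real n * (r n)\<^sup>2) / min (c / 8) (b / 2))"
  have c: "c > 0" "b > 0" using d by (simp_all add: c_def b_def)
  have r: "0 \<le> r n" "r n \<le> 1" "r n \<le> p n" for n
    using p[of n] by (auto simp: r_def min_le_iff_disj)
  have min_lim: "filterlim (\<lambda>n. min (p n / real n powr (-(2/3))) (real n powr (1/15))) at_top sequentially"
  proof -
    have "filterlim (\<lambda>n. real n powr (1/15)) at_top sequentially" by real_asymp
    then show ?thesis using lim unfolding filterlim_at_top by (auto intro: eventually_conj)
  qed
  have min_eq: "\<forall>\<^sub>F n in sequentially. min (p n / real n powr (-(2/3))) (real n powr (1/15)) = r n * real n powr (2/3)"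
    using eventually_gt_at_top[of 0]
  proof eventually_elim
    case (elim n)
    have "real n powr (1/15) = real n powr (-(3/5)) * real n powr (2/3)"
      by (simp flip: powr_add)
    moreover have "p n / real n powr (-(2/3)) = p n * real n powr (2/3)"
      by (simp add: powr_minus_divide)
    ultimately show ?case by (simp add: r_def min_mult_distrib_right)
  qed
  have r_lim: "filterlim (\<lambda>n. r n * real n powr (2/3)) at_top sequentially"
    using min_lim unfolding filterlim_cong[OF refl refl min_eq] .
  \<comment> \<open>Shows that q/n is the cube of the ratio of \<open>r\<close> to the threshold, so
    it tends to infinity.\<close>
  have q_eq: "q n = real n * (r n * real n powr (2/3)) ^ 3" for n
  proof -
    have "(real n powr (2/3)) ^ 3 = real n ^ 2"
      by (cases "n = 0") (simp_all add: powr_power powr_numeral)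
    then show ?thesis by (simp add: q_def power_mult_distrib power2_eq_square power3_eq_cube)
  qed
  have q_lin: "\<forall>\<^sub>F n in sequentially. K * real n < q n" for K
  proof -
    have "\<forall>\<^sub>F n in sequentially. max 1 (K + 1) \<le> r n * real n powr (2/3)"
      using r_lim unfolding filterlim_at_top by blast
    then show ?thesis using eventually_gt_at_top[of 0]
    proof eventually_elim
      case (elim n)
      have "K < r n * real n powr (2/3)" "1 \<le> r n * real n powr (2/3)" using elim by auto
      moreover from this(2) have "r n * real n powr (2/3) \<le> (r n * real n powr (2/3)) ^ 3"
        by (intro self_le_power) auto
      ultimately have "K < (r n * real n powr (2/3)) ^ 3" by linarith
      then show ?case using elim by (simp add: q_eq mult.commute)
    qed
  qed
  have q_top: "filterlim q at_top sequentially"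
  proof (rule filterlim_at_top_mono)
    show "filterlim real at_top sequentially" by (rule filterlim_real_sequentially)
    show "\<forall>\<^sub>F n in sequentially. real n \<le> q n"
      using q_lin[of 1] by eventually_elim simp
  qed
  have nr2: "real n * (r n)\<^sup>2 \<le> real n powr (-(1/5))" if "n > 0" for n
  proof -
    have "real n * (r n)\<^sup>2 \<le> real n * (real n powr (-(3/5)))\<^sup>2"
      using r[of n] by (intro mult_left_mono power_mono) (auto simp: r_def)
    also have "\<dots> = real n powr 1 * real n powr (-(6/5))" using that by (simp add: powr_power)
    also have "\<dots> = real n powr (-(1/5))" by (subst powr_add[symmetric]) simp
    finally show ?thesis .
  qed
  have nr2_lim: "(\<lambda>n. real n * (r n)\<^sup>2) \<longlonglongrightarrow> 0"
  proof (rule tendsto_sandwich[OF _ _ tendsto_const])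
    show "\<forall>\<^sub>F n in sequentially. real n * (r n)\<^sup>2 \<le> real n powr (-(1/5))"
      using eventually_gt_at_top[of 0] by eventually_elim (rule nr2)
    show "(\<lambda>n. real n powr (-(1/5))) \<longlonglongrightarrow> 0" by real_asymp
  qed (simp add: always_eventually)
  have "err \<longlonglongrightarrow> 0"
  proof -
    have inv: "(\<lambda>n. k / (l * q n)) \<longlonglongrightarrow> 0" if "l > 0" for k l :: real
      using that q_top by (intro real_tendsto_divide_at_top[OF tendsto_const] filterlim_tendsto_pos_mult_at_top[OF tendsto_const])
    have "err \<longlonglongrightarrow> 0 + 0 + 0 + 3 * 0 / min (c / 8) (b / 2)"
      unfolding err_def using inv[of 1 4] inv[of "c\<^sup>2" 16] inv[of "b\<^sup>2 * c" 16] c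
      by (intro tendsto_add tendsto_divide tendsto_mult tendsto_const nr2_lim) auto
    then show ?thesis by simp
  qed
  then have lower: "(\<lambda>n. 1 - err n) \<longlonglongrightarrow> 1" using tendsto_diff[OF tendsto_const, of err 0 sequentially 1] by simp
  show ?thesis
  proof (rule tendsto_sandwich[OF _ _ lower tendsto_const])
    have "\<forall>\<^sub>F n in sequentially. 3 / c \<le> real n" "\<forall>\<^sub>F n in sequentially. 24 / d \<le> real n" by real_asymp+
    then show "\<forall>\<^sub>F n in sequentially. 1 - err n \<le> gnp_prob n (p n) (\<lambda>R. rbw_K6 (G n \<union> R))"
      using eventually_ge_at_top[of 2] q_lin[of 0] q_lin[of "576 / (c * b)"]
    proof eventually_elim
      case (elim n)
      have GE: "G n \<subseteq> all_pairs n" using G[OF elim(3)] by (simp add: dense_family_def)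
      have "real n powr (-(1/5)) \<le> 1" using elim by (intro powr_minus_le_1) auto
      then have nr1: "real n * (r n)\<^sup>2 \<le> 1" using nr2[of n] elim by auto
      have "gnp_prob n (r n) (\<lambda>R. \<not> rbw_K6 (G n \<union> R)) \<le> err n"
        unfolding err_def q_def b_def
      proof (rule gnp_prob_not_rbw_K6_le[OF GE r(1,2) nr1 c(1)])
        show "3 \<le> c * real n" using elim(1) c by (simp add: pos_divide_le_eq mult.commute)
        show "c * real n ^ 3 \<le> real (card {T \<in> triples {..<n}. c * real n \<le> real (card (common_nbrs (G n) n T))})"
          unfolding c_def by (rule many_good_triples[OF d elim(2,3) G[OF elim(3)]])
        show "0 < real n ^ 3 * r n ^ 3" using elim(4) by (simp add: q_def)
        have "576 * real n < c * b * q n" using elim(5) c by (simp add: pos_divide_less_eq mult.commute)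
        then show "576 * real n < c * ((c / 3) ^ 3 / 2) * (real n ^ 3 * r n ^ 3)"
          unfolding b_def q_def .
      qed
      then have "1 - err n \<le> gnp_prob n (r n) (\<lambda>R. rbw_K6 (G n \<union> R))"
        by (simp add: gnp_prob_compl)
      \<comment> \<open>The property is increasing: a proper colouring of the larger graph restricts
        to one of the smaller.\<close>
      also have "\<dots> \<le> gnp_prob n (p n) (\<lambda>R. rbw_K6 (G n \<union> R))"
        unfolding gnp_prob_eq_gex
      proof (rule gex_mono_prob)
        fix R S :: "nat set set" assume RS: "R \<subseteq> S"
        have "rbw_K6 (G n \<union> S)" if rbw: "rbw_K6 (G n \<union> R)"
          unfolding rbw_K6_def
        proof (intro allI impI)
          fix col assume "proper_colouring (G n \<union> S) col"
          then have "proper_colouring (G n \<union> R) col" using RS unfolding proper_colouring_def by blast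
          then obtain U where "card U = 6" "pairs_of U \<subseteq> G n \<union> R" "inj_on col (pairs_of U)"
            using rbw unfolding rbw_K6_def by blast
          then show "\<exists>U. card U = 6 \<and> pairs_of U \<subseteq> G n \<union> S \<and> inj_on col (pairs_of U)"
            using RS by (intro exI[of _ U]) auto
        qed
        then show "of_bool (rbw_K6 (G n \<union> R)) \<le> (of_bool (rbw_K6 (G n \<union> S)) :: real)" by auto
      qed (use r p in auto)
      finally show ?case .
    qed
    show "\<forall>\<^sub>F n in sequentially. gnp_prob n (p n) (\<lambda>R. rbw_K6 (G n \<union> R)) \<le> 1"
    proof (rule always_eventually, rule allI)
      fix n
      have "0 \<le> gnp_prob n (p n) (\<lambda>R. \<not> rbw_K6 (G n \<union> R))" using p by (intro gnp_prob_nonneg) auto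
      then show "gnp_prob n (p n) (\<lambda>R. rbw_K6 (G n \<union> R)) \<le> 1" by (simp add: gnp_prob_compl)
    qed
  qed
qed

theorem theorem1p3:
  fixes d :: real
  assumes "0 < d" and "d \<le> 1/2"
  shows
    "(\<forall>p :: nat \<Rightarrow> real.
        (\<forall>n. 0 \<le> p n \<and> p n \<le> 1) \<and>
        filterlim (\<lambda>n. p n / real n powr (-(2/3))) at_top sequentially \<longrightarrow>
        (\<forall>G :: nat \<Rightarrow> nat set set. (\<forall>n\<ge>2. G n \<in> dense_family d n) \<longrightarrow>
           ((\<lambda>n. gnp_prob n (p n) (\<lambda>R. rbw_K6 (G n \<union> R))) \<longlonglongrightarrow> 1)))
     \<and>
     (\<forall>\<epsilon> :: real. \<epsilon> > 0 \<longrightarrow>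
        (\<exists>G :: nat \<Rightarrow> nat set set. (\<forall>n\<ge>2. G n \<in> dense_family d n) \<and>
           ((\<lambda>n. gnp_prob n (real n powr (-(2/3 + \<epsilon>))) (\<lambda>R. \<not> rbw_K6 (G n \<union> R)))
              \<longlonglongrightarrow> 1)))"
  using threshold_upper[OF assms(1)] threshold_lower[OF assms(2)] by blast

end
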